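(* Let $a,b,d_1,d_2$ be rational numbers with $a b d_2(d_1^2-d_2)\neq 0$. Finding all integer solutions $(x,y,z)\in\mathbb{Z}^3$ of the system of Diophantine equations $$\begin{cases} z=a x^2+d_1,\\ z^2=b y^2+d_2\end{cases}$$ reduces to solving a finite number of quartic Thue equations.
   Context: A quartic Thue equation is an equation $g(m,n)=d$ in integer unknowns $m,n$, where $d$ is a non-zero integer and $g\in\mathbb{Z}[m,n]$ is a homogeneous polynomial of degree $4$. Normally $g$ is required to be irreducible; by convention, the lists of equations produced by a reduction may also include "Thue-like" equations in which $g$ is reducible, provided $g$ is not of the form $\kappa\cdot T(m,n)^2$ with $\kappa$ a constant and $T$ a polynomial (so that the equation still has only finitely many integer solutions). "Finding the solutions of a Diophantine problem reduces to solving a finite number of quartic Thue equations" means: there is an algorithm which, from the data of the problem (here $a,b,d_1,d_2$), produces a finite (possibly empty) list of equations $g(m,n)=d$ in integer unknowns $m,n$, each with $d$ a non-zero integer and $g\in\mathbb{Z}[m,n]$ a homogeneous polynomial of degree $4$ that is either irreducible, or reducible but not of the form $\kappa\cdot T(m,n)^2$ with $\kappa$ a constant and $T$ a polynomial, together with an explicit computable rule assigning to each integer solution $(m,n)$ of each equation in the list a finite set of candidates, such that every solution of the problem occurs among the candidates so obtained. *)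

theory Defs
  imports
    Complex_Main
    "HOL-Library.Nat_Bijection"
    "HOL-Computational_Algebra.Polynomial"
begin

section \<open>Computable functions\<close>

text \<open>
  \<open>recursive k f\<close>: on argument lists of length \<open>k\<close>, \<open>f\<close> is a total recursive function of \<open>k\<close>
  variables.  Minimization is restricted to regular functions; by Kleene's normal form theorem
  this still yields every total computable function, so no partial functions are needed.
  The values of \<open>f\<close> on lists of other lengths have no significance.
\<close>

inductive recursive :: "nat \<Rightarrow> (nat list \<Rightarrow> nat) \<Rightarrow> bool" where
  zero: "recursive k (\<lambda>_. 0)"
| succ: "recursive 1 (\<lambda>xs. Suc (xs ! 0))"
| proj: "i < k \<Longrightarrow> recursive k (\<lambda>xs. xs ! i)"
| comp: "recursive (length gs) f \<Longrightarrow> (\<forall>g\<in>set gs. recursive k g)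
          \<Longrightarrow> recursive k (\<lambda>xs. f (map (\<lambda>g. g xs) gs))"
| prec: "recursive k f \<Longrightarrow> recursive (Suc (Suc k)) g
          \<Longrightarrow> recursive (Suc k) (\<lambda>xs. rec_nat (f (tl xs)) (\<lambda>n r. g (n # r # tl xs)) (hd xs))"
| mini: "recursive (Suc k) f \<Longrightarrow> (\<forall>xs. length xs = k \<longrightarrow> (\<exists>n. f (n # xs) = 0))
          \<Longrightarrow> recursive k (\<lambda>xs. LEAST n. f (n # xs) = 0)"

text \<open>Computability of functions between types whose elements are coded by natural numbers.\<close>

definition computable :: "('a \<Rightarrow> nat) \<Rightarrow> ('b \<Rightarrow> nat) \<Rightarrow> ('a \<Rightarrow> 'b) \<Rightarrow> bool" where
  "computable enc_in enc_out F \<longleftrightarrow>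
     (\<exists>h. recursive 1 h \<and> (\<forall>x. h [enc_in x] = enc_out (F x)))"

definition enc_pair :: "('a \<Rightarrow> nat) \<Rightarrow> ('b \<Rightarrow> nat) \<Rightarrow> 'a \<times> 'b \<Rightarrow> nat" where
  "enc_pair e1 e2 p = prod_encode (e1 (fst p), e2 (snd p))"

definition enc_list :: "('a \<Rightarrow> nat) \<Rightarrow> 'a list \<Rightarrow> nat" where
  "enc_list e xs = list_encode (map e xs)"

text \<open>Rationals are coded by numerator and (positive) denominator in lowest terms.\<close>

definition enc_rat :: "rat \<Rightarrow> nat" where
  "enc_rat q = enc_pair int_encode int_encode (quotient_of q)"


section \<open>Quartic Thue equations\<close>

text \<open>
  A polynomial in two unknowns \<open>m\<close>, \<open>n\<close> is an element of \<open>R[n][m]\<close>: the coefficient of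
  \<open>m\<^sup>i n\<^sup>j\<close> in \<open>g\<close> is \<open>coeff (coeff g i) j\<close>.
\<close>

definition eval2 :: "int poly poly \<Rightarrow> int \<Rightarrow> int \<Rightarrow> int" where
  "eval2 g m n = poly (poly g [:m:]) n"

definition homogeneous :: "nat \<Rightarrow> 'a::zero poly poly \<Rightarrow> bool" where
  "homogeneous k g \<longleftrightarrow> g \<noteq> 0 \<and> (\<forall>i j. coeff (coeff g i) j \<noteq> 0 \<longrightarrow> i + j = k)"

definition of_int_poly2 :: "int poly poly \<Rightarrow> 'a::comm_ring_1 poly poly" where
  "of_int_poly2 g = map_poly (map_poly of_int) g"

text \<open>The pair \<open>(g, d)\<close> stands for the equation \<open>g(m,n) = d\<close>.\<close>

type_synonym equation = "int poly poly \<times> int"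

text \<open>
  Irreducibility is meant over the rationals, so that constant factors of \<open>g\<close> do not count;
  the exclusion of \<open>\<kappa> T\<^sup>2\<close> is imposed over the complex numbers.
\<close>

definition quartic_thue_like :: "equation \<Rightarrow> bool" where
  "quartic_thue_like = (\<lambda>(g, d).
     d \<noteq> 0 \<and> homogeneous 4 g \<and>
     (irreducible (of_int_poly2 g :: rat poly poly) \<or>
      \<not> (\<exists>(\<kappa>::complex) (T::complex poly poly). of_int_poly2 g = smult [:\<kappa>:] (T ^ 2))))"

text \<open>
  The code records the coefficients of \<open>m\<^sup>i n\<^bsup>4-i\<^esup>\<close>, \<open>i = 0,\<dots>,4\<close>, and thus determines an
  equation whose left-hand side is homogeneous of degree 4 (it is not injective otherwise).
\<close>

definition enc_equation :: "equation \<Rightarrow> nat" where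
  "enc_equation = enc_pair
     (\<lambda>g. enc_list int_encode (map (\<lambda>i. coeff (coeff g i) (4 - i)) [0..<5])) int_encode"


section \<open>Reduction to quartic Thue equations\<close>

text \<open>
  A problem is a family of solution sets \<open>Sol p\<close>, where \<open>p\<close> ranges over the admissible data
  \<open>Adm\<close>; \<open>enc_p\<close> and \<open>enc_s\<close> are codings of the data and of the solutions.  The algorithm
  \<open>eqs\<close> lists the equations for the data \<open>p\<close>, and \<open>cand (p, i, m, n)\<close> lists the candidates
  attached to the solution \<open>(m,n)\<close> of the \<open>i\<close>-th equation.  Both are total functions,
  with arbitrary values on inadmissible data, on indices out of range and on non-solutions.
\<close>

definition reduces_to_quartic_thue ::
    "('p \<Rightarrow> nat) \<Rightarrow> ('s \<Rightarrow> nat) \<Rightarrow> 'p set \<Rightarrow> ('p \<Rightarrow> 's set) \<Rightarrow> bool" where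
  "reduces_to_quartic_thue enc_p enc_s Adm Sol \<longleftrightarrow>
     (\<exists>(eqs :: 'p \<Rightarrow> equation list) (cand :: 'p \<times> nat \<times> int \<times> int \<Rightarrow> 's list).
        computable enc_p (enc_list enc_equation) eqs \<and>
        computable (enc_pair enc_p (enc_pair id (enc_pair int_encode int_encode)))
          (enc_list enc_s) cand \<and>
        (\<forall>p\<in>Adm.
           (\<forall>e\<in>set (eqs p). quartic_thue_like e) \<and>
           (\<forall>s\<in>Sol p. \<exists>i m n. i < length (eqs p) \<and>
              eval2 (fst (eqs p ! i)) m n = snd (eqs p ! i) \<and>
              s \<in> set (cand (p, i, m, n)))))"

definition enc_data :: "rat \<times> rat \<times> rat \<times> rat \<Rightarrow> nat" where
  "enc_data = enc_pair enc_rat (enc_pair enc_rat (enc_pair enc_rat enc_rat))"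

definition enc_int3 :: "int \<times> int \<times> int \<Rightarrow> nat" where
  "enc_int3 = enc_pair int_encode (enc_pair int_encode int_encode)"

end

theory Submission
  imports Defs "HOL-Analysis.Kronecker_Approximation_Theorem"
begin

text \<open>
  Why the reduction works.  After multiplication by a common denominator the system reads
  \<open>D z = a x\<^sup>2 + d1\<close>, \<open>D z\<^sup>2 = b y\<^sup>2 + d2\<close> with integral data.  The second equation puts \<open>(z, y)\<close> on a
  conic.  A conic with one rational point is parametrized by pairs of binary quadratic forms, and for
  coprime parameters the proportionality factor divides a constant
  (\<open>conic_parametrization\<close>).  Hence, with coprime integers \<open>r, s\<close>, the number
  \<open>k = D r\<^sup>2 - b s\<^sup>2\<close> takes only finitely many values and \<open>z\<close> is a fixed quadratic form in \<open>r, s\<close> up to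
  a known factor.  The first equation becomes \<open>q(r, s) = A x\<^sup>2\<close> for a binary quadratic form \<open>q\<close>: a
  second conic, nondegenerate because \<open>d1\<^sup>2 \<noteq> D d2\<close>.  Its parametrization by \<open>u, v\<close>, substituted
  into \<open>D r\<^sup>2 - b s\<^sup>2 = k\<close>, yields a quartic equation \<open>g(u, v) = \<nu>\<^sup>2 k\<close>
  (\<open>thue_equation_of_solution\<close>).  The form \<open>g\<close> is not a constant times a square
  (\<open>composed_quartic_not_square\<close>): at a multiple root of \<open>g\<close> the second parametrization would ramify,
  which happens only at the roots of \<open>q\<close>, and these are not mapped to roots of \<open>D r\<^sup>2 - b s\<^sup>2\<close>.

  Why it is computable.  The construction starts from rational points on two conics.  By Cassels'
  theorem on small zeros of quadratic forms (\<open>small_zero\<close>) such points, if there are any, can be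
  chosen of size polynomial in the coefficients.  Therefore the coefficients and right-hand sides of
  all quartic equations that can arise are bounded by a fixed power of the size of the data.  No search
  for base points has to be carried out: the algorithm lists all equations below this bound
  for which a polynomial test (\<open>square_obstruction\<close>) certifies that they are of the admissible kind.
  Likewise \<open>x, y, z\<close> are bounded by a fixed power of the size of the data together with \<open>u, v\<close>, and the
  candidates attached to \<open>(u, v)\<close> are simply all triples below that bound.
\<close>

section \<open>Small zeros of ternary quadratic forms\<close>

text \<open>
  The symmetric bilinear form whose diagonal is the ternary quadratic form with diagonal
  coefficients \<open>p, q, r\<close> and off-diagonal Gram entries \<open>s, t, w\<close>.
\<close>

definition tern_polar ::
  "'a::comm_ring_1 \<times> 'a \<times> 'a \<times> 'a \<times> 'a \<times> 'a \<Rightarrow> 'a \<times> 'a \<times> 'a \<Rightarrow> 'a \<times> 'a \<times> 'a \<Rightarrow> 'a" where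
  "tern_polar = (\<lambda>(p, q, r, s, t, w) (x, y, z) (x', y', z').
     p * x * x' + q * y * y' + r * z * z' +
     s * (y * z' + z * y') + t * (x * z' + z * x') + w * (x * y' + y * x'))"

lemma tern_polar_swap_yz:
  "tern_polar (p, r, q, s, w, t) (x, z, y) (x', z', y') = tern_polar (p, q, r, s, t, w) (x, y, z) (x', y', z')"
  by (simp add: tern_polar_def algebra_simps)

lemma tern_polar_swap_xz:
  "tern_polar (r, q, p, w, t, s) (z, y, x) (z', y', x') = tern_polar (p, q, r, s, t, w) (x, y, z) (x', y', z')"
  by (simp add: tern_polar_def algebra_simps)

text \<open>
  For an isotropic vector \<open>a\<close> and any \<open>b\<close>, the vector \<open>F(b) a - 2 B(a,b) b\<close> is the multiple by
  \<open>F(b)\<close> of the mirror image of \<open>a\<close>, hence isotropic again.  If \<open>b = l a + e\<close>, everything that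
  involves \<open>l\<close> cancels and only terms quadratic in \<open>e\<close> survive, so that a vector \<open>b\<close> close to the
  line of \<open>a\<close> produces a short mirror image.
\<close>

lemma reflection_of_near_multiple:
  fixes p q r s t w x y z l e1 e2 :: real
  assumes "tern_polar (p, q, r, s, t, w) (x, y, z) (x, y, z) = 0"
  defines "b \<equiv> (l * x + e1, l * y + e2, l * z)"
  defines "Fb \<equiv> tern_polar (p, q, r, s, t, w) b b"
  defines "Bab \<equiv> tern_polar (p, q, r, s, t, w) (x, y, z) b"
  defines "Fe \<equiv> p * e1\<^sup>2 + q * e2\<^sup>2 + 2 * w * e1 * e2"
  defines "Bae \<equiv> e1 * (p * x + w * y + t * z) + e2 * (w * x + q * y + s * z)"
  shows "Fb * x - 2 * Bab * (l * x + e1) = Fe * x - 2 * Bae * e1"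
    and "Fb * y - 2 * Bab * (l * y + e2) = Fe * y - 2 * Bae * e2"
    and "Fb * z - 2 * Bab * (l * z) = Fe * z"
proof -
  have z: "p * x * x + q * y * y + r * z * z + s * (y * z + z * y) + t * (x * z + z * x)
      + w * (x * y + y * x) = 0"
    using assms(1) by (simp add: tern_polar_def)
  have B: "Bab = Bae" 
    unfolding Bab_def Bae_def b_def tern_polar_def using z by simp algebra
  have F: "Fb = Fe + 2 * l * Bae"
    unfolding Fb_def Bae_def Fe_def b_def tern_polar_def using z by simp algebra
  show "Fb * x - 2 * Bab * (l * x + e1) = Fe * x - 2 * Bae * e1"
    "Fb * y - 2 * Bab * (l * y + e2) = Fe * y - 2 * Bae * e2"
    "Fb * z - 2 * Bab * (l * z) = Fe * z"
    unfolding B F by (simp_all add: algebra_simps)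
qed

text \<open>
  Cassels' descent.  Dirichlet's theorem supplies an integral vector \<open>b\<close>, shorter than the given
  zero \<open>a = (x, y, z)\<close>, which differs from a multiple of \<open>a\<close> by at most \<open>1/N\<close>.  Either \<open>b\<close> is
  itself a zero, or the mirror image of \<open>a\<close> is one; its coordinates are at most
  \<open>16 C z / N\<^sup>2\<close>, which is less than \<open>z\<close> for \<open>N = 16 C\<close>.
\<close>

lemma smaller_zero:
  fixes p q r s t w x y z C :: int
  assumes C: "C \<ge> 1" "\<bar>p\<bar> \<le> C" "\<bar>q\<bar> \<le> C" "\<bar>r\<bar> \<le> C" "\<bar>s\<bar> \<le> C" "\<bar>t\<bar> \<le> C" "\<bar>w\<bar> \<le> C"
    and zero: "tern_polar (p, q, r, s, t, w) (x, y, z) (x, y, z) = 0"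
    and z: "\<bar>x\<bar> \<le> z" "\<bar>y\<bar> \<le> z" "z > (16 * C)\<^sup>2"
  obtains x' y' z' where "tern_polar (p, q, r, s, t, w) (x', y', z') (x', y', z') = 0"
    "(x', y', z') \<noteq> (0, 0, 0)" "\<bar>x'\<bar> < z" "\<bar>y'\<bar> < z" "\<bar>z'\<bar> < z"
proof -
  define N where "N = nat (16 * C)"
  have N: "N > 0" "real N = 16 * of_int C" "int N = 16 * C" using C(1) by (auto simp: N_def)
  define \<theta> where "\<theta> i = (if i = (0::nat) then of_int x / of_int z else of_int y / of_int z :: real)" for i
  obtain b3 bb where b3: "0 < b3" "b3 \<le> int (N ^ 2)"
    and app: "\<And>i. i < 2 \<Longrightarrow> \<bar>of_int b3 * \<theta> i - of_int (bb i)\<bar> < 1 / N"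
    using Dirichlet_approx_simult[OF N(1), where n = 2] by metis
  define b1 b2 where "b1 = bb 0" and "b2 = bb 1"
  have b3z: "b3 < z" using b3(2) z(3) N(3) by simp
  have zpos: "z > 0" using b3 b3z by linarith
  define l :: real where "l = of_int b3 / of_int z"
  \<comment> \<open>the last coordinate of the error vanishes by the choice of \<open>l\<close>\<close>
  define e1 e2 :: real where "e1 = of_int b1 - l * x" and "e2 = of_int b2 - l * y"
  define d :: real where "d = 1 / N"
  have e: "\<bar>e1\<bar> \<le> d" "\<bar>e2\<bar> \<le> d"
    using app[of 0] app[of 1] by (simp_all add: \<theta>_def e1_def e2_def l_def b1_def b2_def d_def abs_minus_commute)
  have "d < 1" using N C(1) by (simp add: d_def)
  have e': "\<bar>e1\<bar> < 1" "\<bar>e2\<bar> < 1"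
  proof -
    show "\<bar>e1\<bar> < 1" "\<bar>e2\<bar> < 1" using e \<open>d < 1\<close> by linarith+
  qed
  have small: "\<bar>b1\<bar> \<le> b3" "\<bar>b2\<bar> \<le> b3"
  proof -
    have "\<bar>l * x\<bar> \<le> of_int b3" "\<bar>l * y\<bar> \<le> of_int b3"
      using z(1,2) zpos b3(1) by (simp_all add: l_def abs_mult field_simps flip: of_int_abs of_int_mult)
    hence "\<bar>real_of_int b1\<bar> < of_int b3 + 1" "\<bar>real_of_int b2\<bar> < of_int b3 + 1"
      using e' unfolding e1_def e2_def by linarith+
    thus "\<bar>b1\<bar> \<le> b3" "\<bar>b2\<bar> \<le> b3" by linarith+
  qed
  define Fb where "Fb = tern_polar (p, q, r, s, t, w) (b1, b2, b3) (b1, b2, b3)"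
  define Bab where "Bab = tern_polar (p, q, r, s, t, w) (x, y, z) (b1, b2, b3)"
  show thesis
  proof (cases "Fb = 0")
    case True
    show thesis by (rule that[of b1 b2 b3]) (use True b3 small b3z in \<open>auto simp: Fb_def\<close>)
  next
    case False
    define x' y' z' where "x' = Fb * x - 2 * Bab * b1" and "y' = Fb * y - 2 * Bab * b2"
      and "z' = Fb * z - 2 * Bab * b3"
    have z0: "p * x * x + q * y * y + r * z * z + s * (y * z + z * y) + t * (x * z + z * x)
      + w * (x * y + y * x) = 0"
      using zero by (simp add: tern_polar_def)
    have iso: "tern_polar (p, q, r, s, t, w) (x', y', z') (x', y', z') = 0"
    proof -
      have "tern_polar (p, q, r, s, t, w) (x', y', z') (x', y', z') =
        Fb\<^sup>2 * tern_polar (p, q, r, s, t, w) (x, y, z) (x, y, z)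
        - 4 * Fb * Bab * tern_polar (p, q, r, s, t, w) (x, y, z) (b1, b2, b3)
        + 4 * Bab\<^sup>2 * tern_polar (p, q, r, s, t, w) (b1, b2, b3) (b1, b2, b3)"
        unfolding x'_def y'_def z'_def by (simp add: tern_polar_def algebra_simps power2_eq_square)
      thus ?thesis using zero by (simp flip: Fb_def Bab_def add: power2_eq_square)
    qed
    have nz: "(x', y', z') \<noteq> (0, 0, 0)"
    proof
      assume "(x', y', z') = (0, 0, 0)"
      hence eq: "Fb * x = 2 * Bab * b1" "Fb * y = 2 * Bab * b2" "Fb * z = 2 * Bab * b3"
        by (auto simp: x'_def y'_def z'_def)
      \<comment> \<open>pair the mirror image with \<open>a\<close> itself\<close>
      have "Fb * tern_polar (p, q, r, s, t, w) (x, y, z) (x, y, z) = 2 * Bab * Bab"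
      proof -
        have "Fb * tern_polar (p, q, r, s, t, w) (x, y, z) (x, y, z) =
           tern_polar (p, q, r, s, t, w) (x, y, z) (Fb * x, Fb * y, Fb * z)"
          by (simp add: tern_polar_def algebra_simps)
        also have "\<dots> = 2 * Bab * tern_polar (p, q, r, s, t, w) (x, y, z) (b1, b2, b3)"
          unfolding eq by (simp add: tern_polar_def algebra_simps)
        finally show ?thesis by (simp add: Bab_def)
      qed
      hence "Bab = 0" using zero by simp
      hence "Fb * z = 0" using eq by simp
      thus False using False zpos by simp
    qed
    define Fe where "Fe = p * e1\<^sup>2 + q * e2\<^sup>2 + 2 * w * e1 * e2"
    define Bae where "Bae = e1 * (p * x + w * y + t * z) + e2 * (w * x + q * y + s * z)"
    have zeroR: "tern_polar (real_of_int p, real_of_int q, real_of_int r, real_of_int s, real_of_int t, real_of_int w)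
       (real_of_int x, real_of_int y, real_of_int z) (real_of_int x, real_of_int y, real_of_int z) = 0"
      using arg_cong[OF zero, of real_of_int] by (simp add: tern_polar_def)
    have bR: "l * x + e1 = b1" "l * y + e2 = b2" "l * z = b3"
      using zpos by (simp_all add: e1_def e2_def l_def)
    have FbR: "real_of_int Fb = tern_polar (real_of_int p, real_of_int q, real_of_int r, real_of_int s, real_of_int t, real_of_int w)
       (real_of_int b1, real_of_int b2, real_of_int b3) (real_of_int b1, real_of_int b2, real_of_int b3)"
      and BabR: "real_of_int Bab = tern_polar (real_of_int p, real_of_int q, real_of_int r, real_of_int s, real_of_int t, real_of_int w)
       (real_of_int x, real_of_int y, real_of_int z) (real_of_int b1, real_of_int b2, real_of_int b3)"
      by (simp_all add: Fb_def Bab_def tern_polar_def)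
    have xR: "real_of_int x' = Fe * x - 2 * Bae * e1" "real_of_int y' = Fe * y - 2 * Bae * e2"
      "real_of_int z' = Fe * z"
      using reflection_of_near_multiple[OF zeroR, of l e1 e2, unfolded bR, folded FbR BabR]
      by (simp_all only: x'_def y'_def z'_def Fe_def Bae_def of_int_diff of_int_add of_int_mult of_int_numeral)
    define c Z :: real where "c = of_int C" and "Z = of_int z"
    have d0: "d > 0" using N by (simp add: d_def)
    have cR: "\<bar>real_of_int p\<bar> \<le> c" "\<bar>real_of_int q\<bar> \<le> c" "\<bar>real_of_int s\<bar> \<le> c" "\<bar>real_of_int t\<bar> \<le> c" "\<bar>real_of_int w\<bar> \<le> c"
      using C by (simp_all add: c_def flip: of_int_abs)
    have zR: "\<bar>real_of_int x\<bar> \<le> Z" "\<bar>real_of_int y\<bar> \<le> Z" "\<bar>real_of_int z\<bar> \<le> Z" "Z > 0" "c \<ge> 1"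
      using z zpos C by (simp_all add: c_def Z_def flip: of_int_abs)
    have prod: "\<bar>u * v\<bar> \<le> U * V" if "\<bar>u\<bar> \<le> U" "\<bar>v\<bar> \<le> V" for u v U V :: real
      using that by (simp add: abs_mult mult_mono')
    have Fe: "\<bar>Fe\<bar> \<le> 4 * c * d\<^sup>2"
    proof -
      have "\<bar>p * (e1 * e1)\<bar> \<le> c * (d * d)" "\<bar>q * (e2 * e2)\<bar> \<le> c * (d * d)" "\<bar>w * (e1 * e2)\<bar> \<le> c * (d * d)"
        by (intro prod cR e)+
      thus ?thesis unfolding Fe_def by (simp add: power2_eq_square algebra_simps)
    qed
    have Bae: "\<bar>Bae\<bar> \<le> 6 * c * d * Z"
    proof -
      have "\<bar>e1 * (p * x)\<bar> \<le> d * (c * Z)" "\<bar>e1 * (w * y)\<bar> \<le> d * (c * Z)" "\<bar>e1 * (t * z)\<bar> \<le> d * (c * Z)"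
         "\<bar>e2 * (w * x)\<bar> \<le> d * (c * Z)" "\<bar>e2 * (q * y)\<bar> \<le> d * (c * Z)" "\<bar>e2 * (s * z)\<bar> \<le> d * (c * Z)"
        by (simp_all only: of_int_mult) (intro prod cR e zR)+
      thus ?thesis unfolding Bae_def by (simp add: algebra_simps)
    qed
    have bound: "\<bar>Fe * u - 2 * Bae * f\<bar> < Z" if "\<bar>u\<bar> \<le> Z" "\<bar>f\<bar> \<le> d" for u f
    proof -
      have "\<bar>Fe * u\<bar> \<le> 4 * c * d\<^sup>2 * Z" "\<bar>Bae * f\<bar> \<le> 6 * c * d * Z * d"
        by (intro prod Fe Bae that)+
      hence "\<bar>Fe * u - 2 * Bae * f\<bar> \<le> 16 * c * d\<^sup>2 * Z" by (simp add: power2_eq_square algebra_simps)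
      also have "16 * c * d\<^sup>2 * Z = d * Z"
        using N(1) by (simp add: d_def c_def power2_eq_square flip: N(2))
      also have "\<dots> < Z" using zR(4) \<open>d < 1\<close> by simp
      finally show ?thesis .
    qed
    have "\<bar>real_of_int x'\<bar> < Z" "\<bar>real_of_int y'\<bar> < Z" "\<bar>real_of_int z'\<bar> < Z"
      using bound[of x e1] bound[of y e2] bound[of z 0] zR e d0 by (simp_all add: xR)
    hence "\<bar>x'\<bar> < z" "\<bar>y'\<bar> < z" "\<bar>z'\<bar> < z" by (simp_all add: Z_def flip: of_int_abs)
    with iso nz show thesis by (rule that)
  qed
qed

text \<open>
  A zero of least height cannot be lowered by the descent step.  The bound is explicit in the
  coefficients, so a search for a zero can be cut off at a computable point.
\<close>

lemma small_zero:
  fixes p q r s t w x y z C :: int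
  assumes C: "C \<ge> 1" "\<bar>p\<bar> \<le> C" "\<bar>q\<bar> \<le> C" "\<bar>r\<bar> \<le> C" "\<bar>s\<bar> \<le> C" "\<bar>t\<bar> \<le> C" "\<bar>w\<bar> \<le> C"
    and "tern_polar (p, q, r, s, t, w) (x, y, z) (x, y, z) = 0" "(x, y, z) \<noteq> (0, 0, 0)"
  shows "\<exists>x' y' z'. tern_polar (p, q, r, s, t, w) (x', y', z') (x', y', z') = 0 \<and>
    (x', y', z') \<noteq> (0, 0, 0) \<and> \<bar>x'\<bar> \<le> (16 * C)\<^sup>2 \<and> \<bar>y'\<bar> \<le> (16 * C)\<^sup>2 \<and> \<bar>z'\<bar> \<le> (16 * C)\<^sup>2"
proof -
  define height :: "int \<Rightarrow> int \<Rightarrow> int \<Rightarrow> int" where "height x y z = max \<bar>x\<bar> (max \<bar>y\<bar> \<bar>z\<bar>)" for x y z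
  have le_height: "\<bar>x\<bar> \<le> height x y z" "\<bar>y\<bar> \<le> height x y z" "\<bar>z\<bar> \<le> height x y z" for x y z
    by (simp_all add: height_def le_max_iff_disj)
  have height_cases: "height x y z = \<bar>z\<bar> \<or> height x y z = \<bar>y\<bar> \<or> height x y z = \<bar>x\<bar>" for x y z
    by (simp add: height_def max_def)
  have height_less: "nat (height x y z) < nat m" if "\<bar>x\<bar> < m" "\<bar>y\<bar> < m" "\<bar>z\<bar> < m" for x y z m
  proof -
    have "height x y z < m" "0 < m" using that unfolding height_def by (simp, linarith)
    thus ?thesis by simp
  qed
  show ?thesis using assms(8,9)
  proof (induction "nat (height x y z)" arbitrary: x y z rule: less_induct)
    case (less x y z)
    define m where "m = height x y z"
    have le: "\<bar>x\<bar> \<le> m" "\<bar>y\<bar> \<le> m" "\<bar>z\<bar> \<le> m" unfolding m_def by (rule le_height)+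
    show ?case
    proof (cases "m \<le> (16 * C)\<^sup>2")
      case True
      hence "\<bar>x\<bar> \<le> (16 * C)\<^sup>2" "\<bar>y\<bar> \<le> (16 * C)\<^sup>2" "\<bar>z\<bar> \<le> (16 * C)\<^sup>2"
        using le by (auto intro: order_trans)
      thus ?thesis using less.prems by blast
    next
      case False
      have down: ?thesis if "tern_polar (p, q, r, s, t, w) (x', y', z') (x', y', z') = 0"
        "(x', y', z') \<noteq> (0, 0, 0)" "\<bar>x'\<bar> < m" "\<bar>y'\<bar> < m" "\<bar>z'\<bar> < m" for x' y' z'
        using less.hyps[OF _ that(1,2)] height_less[OF that(3-5)] unfolding m_def by blast
      define sg :: "int \<Rightarrow> int" where "sg u = (if u < 0 then -1 else 1)" for u
      have sg: "sg u * u = \<bar>u\<bar>" "\<bar>sg u * v\<bar> = \<bar>v\<bar>" for u v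
        by (auto simp: sg_def)
      \<comment> \<open>normalise so that the dominant coordinate is positive and comes last\<close>
      have neg: "tern_polar (p, q, r, s, t, w) (sg u * x, sg u * y, sg u * z) (sg u * x, sg u * y, sg u * z) = 0" for u
        using less.prems(1) by (auto simp: sg_def tern_polar_def)
      have "m = \<bar>z\<bar> \<or> m = \<bar>y\<bar> \<or> m = \<bar>x\<bar>" unfolding m_def by (rule height_cases)
      show ?thesis using \<open>m = \<bar>z\<bar> \<or> m = \<bar>y\<bar> \<or> m = \<bar>x\<bar>\<close>
      proof (elim disjE)
        assume 1: "m = \<bar>z\<bar>"
        have bd: "\<bar>sg z * x\<bar> \<le> \<bar>z\<bar>" "\<bar>sg z * y\<bar> \<le> \<bar>z\<bar>" "(16 * C)\<^sup>2 < \<bar>z\<bar>"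
          using le False by (simp_all only: sg(2) 1[symmetric] not_le)
        have eq: "tern_polar (p, q, r, s, t, w) (sg z * x, sg z * y, \<bar>z\<bar>) (sg z * x, sg z * y, \<bar>z\<bar>) = 0"
          using neg[of z] by (simp only: sg)
        obtain x' y' z' where "tern_polar (p, q, r, s, t, w) (x', y', z') (x', y', z') = 0"
           "(x', y', z') \<noteq> (0, 0, 0)" "\<bar>x'\<bar> < \<bar>z\<bar>" "\<bar>y'\<bar> < \<bar>z\<bar>" "\<bar>z'\<bar> < \<bar>z\<bar>"
          by (rule smaller_zero[OF C eq bd])
        thus ?thesis by (intro down[unfolded 1, of x' y' z'])
      next
        assume 2: "m = \<bar>y\<bar>"
        have bd: "\<bar>sg y * x\<bar> \<le> \<bar>y\<bar>" "\<bar>sg y * z\<bar> \<le> \<bar>y\<bar>" "(16 * C)\<^sup>2 < \<bar>y\<bar>"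
          using le False by (simp_all only: sg(2) 2[symmetric] not_le)
        have eq: "tern_polar (p, r, q, s, w, t) (sg y * x, sg y * z, \<bar>y\<bar>) (sg y * x, sg y * z, \<bar>y\<bar>) = 0"
          using neg[of y] by (simp only: sg tern_polar_swap_yz[of p r q s w t])
        obtain x' z' y' where w: "tern_polar (p, r, q, s, w, t) (x', z', y') (x', z', y') = 0"
           "(x', z', y') \<noteq> (0, 0, 0)" "\<bar>x'\<bar> < \<bar>y\<bar>" "\<bar>z'\<bar> < \<bar>y\<bar>" "\<bar>y'\<bar> < \<bar>y\<bar>"
          by (rule smaller_zero[OF C(1,2,4,3,5,7,6) eq bd])
        have "(x', y', z') \<noteq> (0, 0, 0)" using w(2) by auto
        thus ?thesis
          using down[unfolded 2, of x' y' z'] w(1,3-5) unfolding tern_polar_swap_yz[of p r q s w t] by blast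
      next
        assume 3: "m = \<bar>x\<bar>"
        have bd: "\<bar>sg x * z\<bar> \<le> \<bar>x\<bar>" "\<bar>sg x * y\<bar> \<le> \<bar>x\<bar>" "(16 * C)\<^sup>2 < \<bar>x\<bar>"
          using le False by (simp_all only: sg(2) 3[symmetric] not_le)
        have eq: "tern_polar (r, q, p, w, t, s) (sg x * z, sg x * y, \<bar>x\<bar>) (sg x * z, sg x * y, \<bar>x\<bar>) = 0"
          using neg[of x] by (simp only: sg tern_polar_swap_xz[of r q p w t s])
        obtain z' y' x' where w: "tern_polar (r, q, p, w, t, s) (z', y', x') (z', y', x') = 0"
           "(z', y', x') \<noteq> (0, 0, 0)" "\<bar>z'\<bar> < \<bar>x\<bar>" "\<bar>y'\<bar> < \<bar>x\<bar>" "\<bar>x'\<bar> < \<bar>x\<bar>"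
          by (rule smaller_zero[OF C(1,4,3,2,7,6,5) eq bd])
        have "(x', y', z') \<noteq> (0, 0, 0)" using w(2) by auto
        thus ?thesis
          using down[unfolded 3, of x' y' z'] w(1,3-5) unfolding tern_polar_swap_xz[of r q p w t s] by blast
      qed
    qed
  qed
qed

section \<open>Parametrization of conics\<close>

definition bin_polar :: "'a::comm_ring_1 \<Rightarrow> 'a \<Rightarrow> 'a \<Rightarrow> 'a \<Rightarrow> 'a \<Rightarrow> 'a \<Rightarrow> 'a \<Rightarrow> 'a" where
  "bin_polar P Q R m n r s = P * m * r + Q * (m * s + n * r) + R * n * s"

text \<open>
  \<open>(refl1, refl2)\<close> is the vector \<open>2 B(v,u) u - q(u) v\<close> with \<open>v = (m, n)\<close> and \<open>u = (r, s)\<close>.  As a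
  function of \<open>u\<close> it is a pair of binary quadratic forms.  If \<open>(v, x0)\<close> lies on the conic
  \<open>q(v) = A x\<^sup>2\<close>, it gives the second point on the line through \<open>(v, x0)\<close> with direction \<open>(u, 0)\<close>,
  that is, the rational parametrization of the conic from that point.
\<close>

definition refl1 :: "'a::comm_ring_1 \<Rightarrow> 'a \<Rightarrow> 'a \<Rightarrow> 'a \<Rightarrow> 'a \<Rightarrow> 'a \<Rightarrow> 'a \<Rightarrow> 'a" where
  "refl1 P Q R m n r s = 2 * bin_polar P Q R m n r s * r - bin_polar P Q R r s r s * m"

definition refl2 :: "'a::comm_ring_1 \<Rightarrow> 'a \<Rightarrow> 'a \<Rightarrow> 'a \<Rightarrow> 'a \<Rightarrow> 'a \<Rightarrow> 'a \<Rightarrow> 'a" where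
  "refl2 P Q R m n r s = 2 * bin_polar P Q R m n r s * s - bin_polar P Q R r s r s * n"

text \<open>
  The parametrization of a conic needs a base point with \<open>x \<noteq> 0\<close>.  A small zero with \<open>x = 0\<close> is
  traded for one with \<open>x \<noteq> 0\<close> by intersecting the conic with a line through it.
\<close>

lemma conic_point:
  fixes P Q R A C m n x :: int
  assumes C: "C \<ge> 1" "\<bar>P\<bar> \<le> C" "\<bar>Q\<bar> \<le> C" "\<bar>R\<bar> \<le> C" "\<bar>A\<bar> \<le> C"
    and det: "P * R - Q\<^sup>2 \<noteq> 0"
    and zero: "bin_polar P Q R m n m n = A * x\<^sup>2" "(m, n) \<noteq> (0, 0)"
  obtains m0 n0 x0 where "bin_polar P Q R m0 n0 m0 n0 = A * x0\<^sup>2" "x0 \<noteq> 0"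
    "\<bar>m0\<bar> \<le> 6 * C * (16 * C)\<^sup>2" "\<bar>n0\<bar> \<le> 6 * C * (16 * C)\<^sup>2" "\<bar>x0\<bar> \<le> 6 * C * (16 * C)\<^sup>2"
proof -
  define S where "S = (16 * C)\<^sup>2"
  note point = that[folded S_def]
  have S: "0 \<le> S" by (simp add: S_def)
  have CS: "S \<le> C * S" using C(1) S by (simp add: mult_le_cancel_right1)
  obtain u v y where uvy: "tern_polar (P, R, -A, 0, 0, Q) (u, v, y) (u, v, y) = 0" "(u, v, y) \<noteq> (0, 0, 0)"
    "\<bar>u\<bar> \<le> S" "\<bar>v\<bar> \<le> S" "\<bar>y\<bar> \<le> S"
    using small_zero[of C P R "-A" 0 0 Q m n x] C zero unfolding S_def
    by (auto simp: tern_polar_def bin_polar_def power2_eq_square algebra_simps)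
  hence q: "bin_polar P Q R u v u v = A * y\<^sup>2"
    by (simp add: tern_polar_def bin_polar_def power2_eq_square algebra_simps)
  show thesis
  proof (cases "y = 0")
    case False
    show thesis by (rule point[of u v y]) (use q False uvy CS S in \<open>simp_all add: mult.assoc\<close>)
  next
    case True
    \<comment> \<open>a line through the zero that is not tangent meets the conic in a second point\<close>
    define B1 B2 where "B1 = P * u + Q * v" and "B2 = Q * u + R * v"
    have q0: "P * u * u + 2 * Q * u * v + R * v * v = 0"
      using q True by (simp add: bin_polar_def algebra_simps)
    have "B1 \<noteq> 0 \<or> B2 \<noteq> 0"
    proof (rule ccontr)
      assume "\<not> (B1 \<noteq> 0 \<or> B2 \<noteq> 0)"
      hence "(P * R - Q\<^sup>2) * u = 0" "(P * R - Q\<^sup>2) * v = 0"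
        unfolding B1_def B2_def by algebra+
      thus False using det uvy(2) True by simp
    qed
    have prod: "\<bar>a * b\<bar> \<le> C * S" if "\<bar>a\<bar> \<le> C" "\<bar>b\<bar> \<le> S" for a b :: int
      using that by (simp add: abs_mult mult_mono')
    have sum: "\<bar>a + b\<bar> \<le> 2 * (C * S)" "\<bar>a - b\<bar> \<le> 2 * (C * S)"
      if "\<bar>a\<bar> \<le> C * S" "\<bar>b\<bar> \<le> C * S" for a b :: int
      using that by linarith+
    have B: "\<bar>B1\<bar> \<le> 2 * (C * S)" "\<bar>B2\<bar> \<le> 2 * (C * S)"
      unfolding B1_def B2_def by (intro sum prod C uvy)+
    have A: "\<bar>(A - P) * w\<bar> \<le> 2 * (C * S)" "\<bar>(A - R) * w\<bar> \<le> 2 * (C * S)" if "\<bar>w\<bar> \<le> S" for w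
      unfolding left_diff_distrib by (intro sum prod C that)+
    have sum2: "\<bar>2 * a + b\<bar> \<le> 6 * C * S" "\<bar>2 * a\<bar> \<le> 6 * C * S" "\<bar>b\<bar> \<le> 6 * C * S"
      if "\<bar>a\<bar> \<le> 2 * (C * S)" "\<bar>b\<bar> \<le> 2 * (C * S)" for a b :: int
      using that unfolding mult.assoc by linarith+
    have nB1: thesis if "B1 \<noteq> 0"
    proof (rule point[of "2 * B1 + (A - P) * u" "(A - P) * v" "2 * B1"])
      show "bin_polar P Q R (2 * B1 + (A - P) * u) ((A - P) * v) (2 * B1 + (A - P) * u) ((A - P) * v)
         = A * (2 * B1)\<^sup>2"
        using q0 unfolding bin_polar_def B1_def by algebra
    qed (use that in simp, (rule sum2 B A uvy)+)
    have nB2: thesis if "B2 \<noteq> 0"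
    proof (rule point[of "(A - R) * u" "2 * B2 + (A - R) * v" "2 * B2"])
      show "bin_polar P Q R ((A - R) * u) (2 * B2 + (A - R) * v) ((A - R) * u) (2 * B2 + (A - R) * v)
         = A * (2 * B2)\<^sup>2"
        using q0 unfolding bin_polar_def B2_def by algebra
    qed (use that in simp, (rule sum2 B A uvy)+)
    show thesis using \<open>B1 \<noteq> 0 \<or> B2 \<noteq> 0\<close> nB1 nB2 by blast
  qed
qed

text \<open>
  The constant plays the role of the resultant of the two quadratic forms of the parametrization:
  it controls their common divisors at coprime arguments.  With \<open>B = B(v,u)\<close> and
  \<open>\<delta> = det(v,u)\<close>, a common divisor \<open>c\<close> divides fixed multiples of \<open>B\<^sup>3\<close> and of \<open>\<delta>\<^sup>3\<close>.  Both
  coordinates of \<open>u\<close>, multiplied by \<open>q(v)\<close>, are integral combinations of \<open>B\<close> and \<open>\<delta>\<close>, and every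
  monomial of degree five in \<open>B\<close> and \<open>\<delta>\<close> contains one of the two cubes.
\<close>

lemma common_divisor_refl:
  fixes P Q R m0 n0 r s c :: int
  assumes co: "coprime r s" and c: "c dvd refl1 P Q R m0 n0 r s" "c dvd refl2 P Q R m0 n0 r s"
  shows "c dvd 2 * (P * R - Q\<^sup>2) * (bin_polar P Q R m0 n0 m0 n0) ^ 5"
proof -
  define N B q \<delta> \<Delta> where "N = bin_polar P Q R m0 n0 m0 n0" and "B = bin_polar P Q R m0 n0 r s"
    and "q = bin_polar P Q R r s r s" and "\<delta> = m0 * s - n0 * r" and "\<Delta> = P * R - Q\<^sup>2"
  define p1 p2 where "p1 = P * m0 + Q * n0" and "p2 = Q * m0 + R * n0"
  define f1 f2 where "f1 = refl1 P Q R m0 n0 r s" and "f2 = refl2 P Q R m0 n0 r s"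
  have f: "f1 = 2 * B * r - q * m0" "f2 = 2 * B * s - q * n0"
    by (simp_all add: f1_def f2_def refl1_def refl2_def B_def q_def)
  have gram: "N * q = B\<^sup>2 + \<Delta> * \<delta>\<^sup>2"
    unfolding N_def q_def B_def \<Delta>_def \<delta>_def bin_polar_def by algebra
  have comb: "c dvd u * f1 + v * f2" for u v using c by (simp add: f1_def f2_def)
  have "2 * B * \<delta> = (- n0) * f1 + m0 * f2" unfolding f \<delta>_def by algebra
  hence 1: "c dvd 2 * B * \<delta>" using comb by metis
  have "q * \<delta> = (- s) * f1 + r * f2" unfolding f \<delta>_def by algebra
  hence 2: "c dvd q * \<delta>" using comb by metis
  have "B * q = (P * r + Q * s) * f1 + (Q * r + R * s) * f2"
    unfolding f B_def q_def bin_polar_def by algebra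
  hence 3: "c dvd B * q" using comb by metis
  have "2 * \<Delta> * B ^ 3 = 2 * \<Delta> * N * (B * q) - \<Delta>\<^sup>2 * \<delta> * (2 * B * \<delta>)" using gram by algebra
  hence B3: "c dvd 2 * \<Delta> * B ^ 3" using 1 3 by (simp add: dvd_diff)
  have "2 * \<Delta> * \<delta> ^ 3 = 2 * N * (q * \<delta>) - B * (2 * B * \<delta>)" using gram by algebra
  hence D3: "c dvd 2 * \<Delta> * \<delta> ^ 3" using 1 2 by (simp add: dvd_diff)
  have five: "c dvd 2 * \<Delta> * (u * B + v * \<delta>) ^ 5" for u v
  proof -
    have "2 * \<Delta> * (u * B + v * \<delta>) ^ 5 =
      (2 * \<Delta> * B ^ 3) * (u ^ 5 * B\<^sup>2 + 5 * u ^ 4 * v * B * \<delta> + 10 * u ^ 3 * v\<^sup>2 * \<delta>\<^sup>2)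
      + (2 * \<Delta> * \<delta> ^ 3) * (10 * u\<^sup>2 * v ^ 3 * B\<^sup>2 + 5 * u * v ^ 4 * B * \<delta> + v ^ 5 * \<delta>\<^sup>2)"
      by algebra
    thus ?thesis using B3 D3 by simp
  qed
  have "N * r = m0 * B + (- p2) * \<delta>" "N * s = n0 * B + p1 * \<delta>"
    unfolding N_def B_def \<delta>_def p1_def p2_def bin_polar_def by algebra+
  hence "c dvd 2 * \<Delta> * (N * r) ^ 5" "c dvd 2 * \<Delta> * (N * s) ^ 5"
    using five[of m0 "- p2"] five[of n0 p1] by simp_all
  hence "c dvd (2 * \<Delta> * N ^ 5) * r ^ 5" "c dvd (2 * \<Delta> * N ^ 5) * s ^ 5"
    by (simp_all add: power_mult_distrib mult.assoc)
  hence "c dvd gcd ((2 * \<Delta> * N ^ 5) * r ^ 5) ((2 * \<Delta> * N ^ 5) * s ^ 5)" by simp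
  also have "\<dots> = \<bar>2 * \<Delta> * N ^ 5\<bar>" using co
    by (simp add: gcd_mult_distrib_int[symmetric] coprime_iff_gcd_eq_1[symmetric] abs_mult)
  finally show ?thesis by (simp add: N_def \<Delta>_def)
qed

text \<open>
  The parameter belonging to the point \<open>(w, x)\<close> is the direction \<open>u = x0 w - x v\<close> of the line
  joining it to the base point \<open>(v, x0)\<close>; dividing \<open>u\<close> by its content leaves a proportionality
  factor \<open>\<mu>\<close> that is confined to the divisors of a constant.  The only point without a joining line
  is the base point.  It is avoided by reflecting the base point: the sign \<open>e\<close> of \<open>x0\<close> is free,
  and nondegeneracy guarantees that one of the two signs works.
\<close>

lemma conic_parametrization:
  fixes P Q R A m0 n0 x0 m n x :: int
  assumes base: "bin_polar P Q R m0 n0 m0 n0 = A * x0\<^sup>2" "x0 \<noteq> 0" "A \<noteq> 0"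
    and det: "P * R - Q\<^sup>2 \<noteq> 0"
    and zero: "bin_polar P Q R m n m n = A * x\<^sup>2" "(m, n) \<noteq> (0, 0)"
  obtains e r s \<mu> where "e = 1 \<or> e = -1" "coprime r s" "\<mu> \<noteq> 0"
    "gcd m n * refl1 P Q R m0 n0 r s = \<mu> * m" "gcd m n * refl2 P Q R m0 n0 r s = \<mu> * n"
    "gcd m n * bin_polar P Q R r s r s * (e * x0) = \<mu> * x"
    "\<mu> dvd 2 * (P * R - Q\<^sup>2) * (A * x0\<^sup>2) ^ 5"
proof -
  define B0 where "B0 = bin_polar P Q R m0 n0 m n"
  have "\<exists>e. (e = 1 \<or> e = -1) \<and> B0 \<noteq> e * (A * x * x0)"
  proof (rule ccontr)
    assume "\<not> ?thesis"
    hence "B0 = A * x * x0" "B0 = - (A * x * x0)" by (auto dest: spec[of _ 1] spec[of _ "-1"])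
    hence B0: "B0 = 0" and x: "x = 0" using base by auto
    have "(P * R - Q\<^sup>2) * (m0 * n - n0 * m)\<^sup>2
        = bin_polar P Q R m0 n0 m0 n0 * bin_polar P Q R m n m n - B0\<^sup>2"
      unfolding B0_def bin_polar_def by algebra
    hence \<delta>: "m0 * n - n0 * m = 0" using det B0 zero(1) x by simp
    have "bin_polar P Q R m0 n0 m0 n0 * m = m0 * B0 - (Q * m0 + R * n0) * (m0 * n - n0 * m)"
      "bin_polar P Q R m0 n0 m0 n0 * n = n0 * B0 + (P * m0 + Q * n0) * (m0 * n - n0 * m)"
      unfolding B0_def bin_polar_def by algebra+
    thus False using B0 \<delta> base zero(2) by auto
  qed
  then obtain e where e: "e = 1 \<or> e = -1" "B0 \<noteq> e * (A * x * x0)" by blast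
  have ee: "e * e = 1" using e by auto
  define r1 s1 where "r1 = e * x0 * m - x * m0" and "s1 = e * x0 * n - x * n0"
  define c where "c = 2 * x0\<^sup>2 * (B0 - e * (A * x * x0))"
  have c0: "c \<noteq> 0" using e base by (auto simp: c_def)
  have N: "P * m0 * m0 + 2 * Q * m0 * n0 + R * n0 * n0 = A * x0 * x0"
    using base(1) by (simp add: bin_polar_def algebra_simps power2_eq_square)
  have Z: "P * m * m + 2 * Q * m * n + R * n * n = A * x * x"
    using zero(1) by (simp add: bin_polar_def algebra_simps power2_eq_square)
  have qv: "bin_polar P Q R r1 s1 r1 s1 = 2 * A * x0\<^sup>2 * x\<^sup>2 - 2 * e * x0 * x * B0"
    unfolding bin_polar_def r1_def s1_def B0_def using N Z ee by algebra
  have Bv: "bin_polar P Q R m0 n0 r1 s1 = e * x0 * B0 - x * A * x0\<^sup>2"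
    unfolding bin_polar_def r1_def s1_def B0_def using N by algebra
  have f1: "refl1 P Q R m0 n0 r1 s1 = c * m"
    unfolding refl1_def qv Bv unfolding r1_def c_def using ee by algebra
  have f2: "refl2 P Q R m0 n0 r1 s1 = c * n"
    unfolding refl2_def qv Bv unfolding s1_def c_def using ee by algebra
  note f = f1 f2
  have fx: "bin_polar P Q R r1 s1 r1 s1 * (- e * x0) = c * x"
    unfolding qv c_def using ee by algebra
  define t where "t = gcd r1 s1"
  have t0: "t \<noteq> 0"
  proof
    assume "t = 0"
    hence "r1 = 0" "s1 = 0" by (simp_all add: t_def)
    hence "c * m = 0" "c * n = 0" using f by (simp_all add: refl1_def refl2_def bin_polar_def)
    thus False using c0 zero(2) by simp
  qed
  obtain r s where rs: "r1 = t * r" "s1 = t * s" "coprime r s"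
    using gcd_coprime_exists[of r1 s1] t0 unfolding t_def by (metis mult.commute)
  define \<gamma> where "\<gamma> = gcd m n"
  have \<gamma>0: "\<gamma> \<noteq> 0" using zero(2) by (auto simp: \<gamma>_def)
  obtain m' n' where mn: "m = \<gamma> * m'" "n = \<gamma> * n'" "coprime m' n'"
    using gcd_coprime_exists[of m n] \<gamma>0 unfolding \<gamma>_def by (metis mult.commute)
  have hom: "refl1 P Q R m0 n0 r1 s1 = t\<^sup>2 * refl1 P Q R m0 n0 r s"
    "refl2 P Q R m0 n0 r1 s1 = t\<^sup>2 * refl2 P Q R m0 n0 r s"
    "bin_polar P Q R r1 s1 r1 s1 = t\<^sup>2 * bin_polar P Q R r s r s"
    unfolding rs(1,2) refl1_def refl2_def bin_polar_def by algebra+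
  have "t\<^sup>2 dvd c * \<gamma> * m'" "t\<^sup>2 dvd c * \<gamma> * n'"
    using f hom mn by (metis dvd_triv_left mult.assoc)+
  hence "t\<^sup>2 dvd gcd (c * \<gamma> * m') (c * \<gamma> * n')" by simp
  also have "\<dots> = \<bar>c * \<gamma>\<bar>" using mn(3)
    by (simp add: gcd_mult_distrib_int[symmetric] abs_mult)
  finally obtain \<mu> where \<mu>: "c * \<gamma> = t\<^sup>2 * \<mu>" by (auto elim: dvdE)
  have t2: "t\<^sup>2 \<noteq> 0" using t0 by simp
  have \<mu>0: "\<mu> \<noteq> 0" using \<mu> c0 \<gamma>0 by auto
  have "t\<^sup>2 * refl1 P Q R m0 n0 r s = t\<^sup>2 * (\<mu> * m')" "t\<^sup>2 * refl2 P Q R m0 n0 r s = t\<^sup>2 * (\<mu> * n')"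
    using f hom mn \<mu> by (metis mult.assoc)+
  hence \<phi>: "refl1 P Q R m0 n0 r s = \<mu> * m'" "refl2 P Q R m0 n0 r s = \<mu> * n'" using t2 by simp_all
  have "t\<^sup>2 * (\<gamma> * bin_polar P Q R r s r s * ((- e) * x0)) = t\<^sup>2 * (\<mu> * x)"
    using fx hom(3) \<mu> by algebra
  hence x: "\<gamma> * bin_polar P Q R r s r s * ((- e) * x0) = \<mu> * x" using t2 by (simp only: mult_cancel_left) blast
  show thesis
  proof (rule that[of "- e" r s \<mu>])
    show "\<mu> dvd 2 * (P * R - Q\<^sup>2) * (A * x0\<^sup>2) ^ 5"
      using common_divisor_refl[OF rs(3), of \<mu> P Q R m0 n0] \<phi> base(1) by simp
    show "gcd m n * refl1 P Q R m0 n0 r s = \<mu> * m" "gcd m n * refl2 P Q R m0 n0 r s = \<mu> * n"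
      unfolding \<phi> \<gamma>_def[symmetric] using mn by simp_all
    show "gcd m n * bin_polar P Q R r s r s * (- e * x0) = \<mu> * x" using x by (simp add: \<gamma>_def)
  qed (use e rs \<mu>0 in auto)
qed

section \<open>Binary quartic forms that are squares\<close>

text \<open>
  If \<open>c4 \<noteq> 0\<close>, completing the square shows that the quartic \<open>g\<close> is a constant times a square
  exactly when \<open>64 c4\<^sup>3 g = (8 c4\<^sup>2 m\<^sup>2 + 4 c3 c4 m n + (4 c2 c4 - c3\<^sup>2) n\<^sup>2)\<^sup>2\<close>.  The coefficients
  of \<open>m\<^sup>4\<close>, \<open>m\<^sup>3 n\<close> and \<open>m\<^sup>2 n\<^sup>2\<close> agree automatically; the first two terms compare those of
  \<open>m n\<^sup>3\<close> and \<open>n\<^sup>4\<close>.  The third term is the second one with \<open>m\<close> and \<open>n\<close> interchanged and settles the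
  case \<open>c4 = 0\<close>.  Over the integers a sum of squares vanishes only termwise, so one integer
  expresses the whole condition.
\<close>

definition square_obstruction :: "int \<Rightarrow> int \<Rightarrow> int \<Rightarrow> int \<Rightarrow> int \<Rightarrow> int" where
  "square_obstruction c0 c1 c2 c3 c4 =
     (8 * c4\<^sup>2 * c1 - c3 * (4 * c2 * c4 - c3\<^sup>2))\<^sup>2 +
     (64 * c4 ^ 3 * c0 - (4 * c2 * c4 - c3\<^sup>2)\<^sup>2)\<^sup>2 +
     (64 * c0 ^ 3 * c4 - (4 * c2 * c0 - c1\<^sup>2)\<^sup>2)\<^sup>2"

text \<open>
  Over the complex numbers a constant factor can be absorbed, so being a constant times a square
  amounts to being the square of \<open>s2 m\<^sup>2 + s1 m n + s0 n\<^sup>2\<close>.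
\<close>

lemma square_obstruction_eq_0_iff:
  "square_obstruction c0 c1 c2 c3 c4 = 0 \<longleftrightarrow>
    (\<exists>s0 s1 s2 :: complex. of_int c4 = s2\<^sup>2 \<and> of_int c3 = 2 * s2 * s1 \<and>
       of_int c2 = s1\<^sup>2 + 2 * s2 * s0 \<and> of_int c1 = 2 * s1 * s0 \<and> of_int c0 = s0\<^sup>2)"
  (is "_ \<longleftrightarrow> ?square")
proof
  assume ?square
  then obtain s0 s1 s2 :: complex where s: "of_int c4 = s2\<^sup>2" "of_int c3 = 2 * s2 * s1"
    "of_int c2 = s1\<^sup>2 + 2 * s2 * s0" "of_int c1 = 2 * s1 * s0" "of_int c0 = s0\<^sup>2" by blast
  have "of_int (8 * c4\<^sup>2 * c1 - c3 * (4 * c2 * c4 - c3\<^sup>2)) = (0 :: complex)"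
    "of_int (64 * c4 ^ 3 * c0 - (4 * c2 * c4 - c3\<^sup>2)\<^sup>2) = (0 :: complex)"
    "of_int (64 * c0 ^ 3 * c4 - (4 * c2 * c0 - c1\<^sup>2)\<^sup>2) = (0 :: complex)"
    unfolding of_int_add of_int_diff of_int_mult of_int_power of_int_numeral s
    by algebra+
  thus "square_obstruction c0 c1 c2 c3 c4 = 0"
    unfolding square_obstruction_def of_int_eq_0_iff by simp
next
  assume "square_obstruction c0 c1 c2 c3 c4 = 0"
  hence E: "8 * c4\<^sup>2 * c1 - c3 * (4 * c2 * c4 - c3\<^sup>2) = 0"
    "64 * c4 ^ 3 * c0 - (4 * c2 * c4 - c3\<^sup>2)\<^sup>2 = 0"
    "64 * c0 ^ 3 * c4 - (4 * c2 * c0 - c1\<^sup>2)\<^sup>2 = 0"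
    unfolding square_obstruction_def by (simp_all add: sum_power2_eq_zero_iff add_nonneg_eq_0_iff)
  show ?square
  proof (cases "c4 = 0")
    case False
    define k3 k2 :: complex where "k3 = of_int c3" and "k2 = of_int c2"
    define \<sigma> :: complex where "\<sigma> = csqrt (of_int c4)"
    have \<sigma>: "\<sigma>\<^sup>2 = of_int c4" "\<sigma> \<noteq> 0" using False by (simp_all add: \<sigma>_def)
    have E1: "8 * (\<sigma>\<^sup>2)\<^sup>2 * of_int c1 = k3 * (4 * k2 * \<sigma>\<^sup>2 - k3\<^sup>2)"
      using arg_cong[OF E(1), of "of_int :: int \<Rightarrow> complex"] by (simp add: \<sigma> k3_def k2_def)
    have E2: "64 * (\<sigma>\<^sup>2) ^ 3 * of_int c0 = (4 * k2 * \<sigma>\<^sup>2 - k3\<^sup>2)\<^sup>2"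
      using arg_cong[OF E(2), of "of_int :: int \<Rightarrow> complex"] by (simp add: \<sigma> k3_def k2_def)
    define s1 s0 where "s1 = k3 / (2 * \<sigma>)" and "s0 = (4 * k2 * \<sigma>\<^sup>2 - k3\<^sup>2) / (8 * \<sigma> ^ 3)"
    have "of_int c1 = 2 * s1 * s0"
    proof -
      have "of_int c1 = k3 * (4 * k2 * \<sigma>\<^sup>2 - k3\<^sup>2) / (8 * (\<sigma>\<^sup>2)\<^sup>2)"
        using E1 \<sigma>(2) by (simp add: field_simps)
      thus ?thesis using \<sigma>(2) by (simp add: s1_def s0_def field_simps power2_eq_square power3_eq_cube)
    qed
    moreover have "of_int c0 = s0\<^sup>2"
    proof -
      have "of_int c0 = (4 * k2 * \<sigma>\<^sup>2 - k3\<^sup>2)\<^sup>2 / (64 * (\<sigma>\<^sup>2) ^ 3)"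
        using E2 \<sigma>(2) by (simp add: field_simps)
      thus ?thesis by (simp add: s0_def power_divide power_mult_distrib flip: power_mult)
    qed
    moreover have "of_int c3 = 2 * \<sigma> * s1" using \<sigma>(2) by (simp add: s1_def k3_def)
    moreover have "of_int c2 = s1\<^sup>2 + 2 * \<sigma> * s0"
      using \<sigma>(2) by (simp add: s1_def s0_def k2_def[symmetric] field_simps power2_eq_square power3_eq_cube)
    ultimately show ?thesis using \<sigma>(1) by metis
  next
    case True
    hence c3: "c3 = 0" and c1: "c1\<^sup>2 = 4 * c2 * c0" using E by auto
    show ?thesis
    proof (cases "c2 = 0")
      case True
      thus ?thesis using c1 c3 \<open>c4 = 0\<close>
        by (intro exI[of _ "csqrt (of_int c0)"] exI[of _ 0]) simp
    next
      case False
      define \<sigma> :: complex where "\<sigma> = csqrt (of_int c2)"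
      have \<sigma>: "\<sigma>\<^sup>2 = of_int c2" "\<sigma> \<noteq> 0" using False by (simp_all add: \<sigma>_def)
      have "(of_int c1)\<^sup>2 = 4 * \<sigma>\<^sup>2 * of_int c0"
        using arg_cong[OF c1, of "of_int :: int \<Rightarrow> complex"] by (simp add: \<sigma>)
      hence "of_int c0 = (of_int c1 / (2 * \<sigma>))\<^sup>2" using \<sigma>(2) by (simp add: field_simps)
      thus ?thesis using c3 \<open>c4 = 0\<close> \<sigma>
        by (intro exI[of _ "of_int c1 / (2 * \<sigma>)"] exI[of _ \<sigma>] exI[of _ 0]) simp
    qed
  qed
qed

lemma complex_pair_root:
  fixes s0 s1 s2 :: complex
  obtains r s where "(r, s) \<noteq> (0, 0)" "s2 * r\<^sup>2 + s1 * r * s + s0 * s\<^sup>2 = 0"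
proof (cases "s2 = 0")
  case True
  thus thesis by (intro that[of 1 0]) auto
next
  case False
  define \<rho> where "\<rho> = csqrt (s1\<^sup>2 - 4 * s2 * s0)"
  have \<rho>: "\<rho>\<^sup>2 = s1\<^sup>2 - 4 * s2 * s0" by (simp add: \<rho>_def)
  define r where "r = (\<rho> - s1) / (2 * s2)"
  have r: "2 * s2 * r + s1 = \<rho>" using False by (simp add: r_def)
  have "4 * s2 * (s2 * r\<^sup>2 + s1 * r + s0) = (2 * s2 * r + s1)\<^sup>2 - (s1\<^sup>2 - 4 * s2 * s0)" by algebra
  hence "4 * s2 * (s2 * r\<^sup>2 + s1 * r + s0) = 0" unfolding r \<rho> by simp
  hence "s2 * r\<^sup>2 + s1 * r + s0 = 0" using False by simp
  thus thesis by (intro that[of r 1]) auto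
qed

text \<open>
  The quartic is \<open>N \<circ> \<phi>\<close> with \<open>N = D r\<^sup>2 - b s\<^sup>2\<close> and \<open>\<phi>\<close> the parametrization of the conic
  \<open>q(r, s) = A x\<^sup>2\<close>, where \<open>q\<close> has coefficients \<open>P, 2 Q, R\<close>.  If it were a square, all its partial
  derivatives would vanish at a root \<open>u\<close> of the square root.  By the chain rule, \<open>\<phi>(u) = 0\<close> or the
  Jacobian of \<open>\<phi>\<close>, a multiple of \<open>q\<close>, vanishes at \<open>u\<close>.  In both cases \<open>q(u) = 0\<close>, so \<open>\<phi>(u)\<close> is
  a nonzero multiple of \<open>u\<close> and \<open>N(u) = 0\<close>.  But \<open>N\<close> and \<open>q\<close> have no common root: on the roots of \<open>N\<close> the form \<open>q\<close> is the
  product of \<open>r\<close> and the linear form \<open>D z0 r - b y0 s\<close> up to a constant, and both factors are nonzero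
  there.  Geometrically, \<open>N \<circ> \<phi>\<close> has four distinct roots because the underlying curve of genus one
  is smooth.
\<close>

lemma composed_quartic_not_square:
  fixes D b d1 d2 z0 y0 x0 P Q R m0 n0 f0 f1 f2 h0 h1 h2 s0 s1 s2 :: complex
  assumes nz: "D \<noteq> 0" "b \<noteq> 0" "d2 \<noteq> 0" "x0 \<noteq> 0"
    and conic: "D * z0\<^sup>2 - b * y0\<^sup>2 = d2 * x0\<^sup>2"
    and PQR: "P = D\<^sup>2 * z0 - d1 * x0 * D" "Q = - b * D * y0" "R = D * b * z0 + d1 * x0 * b"
    and det: "P * R - Q\<^sup>2 \<noteq> 0"
    and aniso: "bin_polar P Q R m0 n0 m0 n0 \<noteq> 0"
    and f: "f2 = P * m0 + 2 * Q * n0" "f1 = 2 * R * n0" "f0 = - R * m0"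
    and h: "h2 = - P * n0" "h1 = 2 * P * m0" "h0 = 2 * Q * m0 + R * n0"
    and sq: "D * f2\<^sup>2 - b * h2\<^sup>2 = s2\<^sup>2" "2 * D * f2 * f1 - 2 * b * h2 * h1 = 2 * s2 * s1"
      "D * (f1\<^sup>2 + 2 * f2 * f0) - b * (h1\<^sup>2 + 2 * h2 * h0) = s1\<^sup>2 + 2 * s2 * s0"
      "2 * D * f1 * f0 - 2 * b * h1 * h0 = 2 * s1 * s0" "D * f0\<^sup>2 - b * h0\<^sup>2 = s0\<^sup>2"
  shows False
proof -
  obtain r s where rs: "(r, s) \<noteq> (0, 0)" "s2 * r\<^sup>2 + s1 * r * s + s0 * s\<^sup>2 = 0"
    using complex_pair_root by blast
  define S where "S = s2 * r\<^sup>2 + s1 * r * s + s0 * s\<^sup>2"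
  define F G where "F = f2 * r\<^sup>2 + f1 * r * s + f0 * s\<^sup>2" and "G = h2 * r\<^sup>2 + h1 * r * s + h0 * s\<^sup>2"
  define Fr Fs Gr Gs where "Fr = 2 * f2 * r + f1 * s" and "Fs = f1 * r + 2 * f0 * s"
    and "Gr = 2 * h2 * r + h1 * s" and "Gs = h1 * r + 2 * h0 * s"
  have S: "S = 0" using rs by (simp add: S_def)
  \<comment> \<open>at a root of the square root all partial derivatives vanish\<close>
  have val: "D * F\<^sup>2 - b * G\<^sup>2 = 0"
  proof -
    have "D * F\<^sup>2 - b * G\<^sup>2 = (D * f2\<^sup>2 - b * h2\<^sup>2) * r ^ 4
      + (2 * D * f2 * f1 - 2 * b * h2 * h1) * r ^ 3 * s
      + (D * (f1\<^sup>2 + 2 * f2 * f0) - b * (h1\<^sup>2 + 2 * h2 * h0)) * r\<^sup>2 * s\<^sup>2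
      + (2 * D * f1 * f0 - 2 * b * h1 * h0) * r * s ^ 3 + (D * f0\<^sup>2 - b * h0\<^sup>2) * s ^ 4"
      unfolding F_def G_def by algebra
    also have "\<dots> = S\<^sup>2" unfolding sq S_def by algebra
    finally show ?thesis using S by simp
  qed
  have dr: "D * F * Fr - b * G * Gr = 0"
  proof -
    have "2 * (D * F * Fr - b * G * Gr) = 4 * (D * f2\<^sup>2 - b * h2\<^sup>2) * r ^ 3
      + 3 * (2 * D * f2 * f1 - 2 * b * h2 * h1) * r\<^sup>2 * s
      + 2 * (D * (f1\<^sup>2 + 2 * f2 * f0) - b * (h1\<^sup>2 + 2 * h2 * h0)) * r * s\<^sup>2
      + (2 * D * f1 * f0 - 2 * b * h1 * h0) * s ^ 3"
      unfolding F_def G_def Fr_def Gr_def by algebra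
    also have "\<dots> = 2 * S * (2 * s2 * r + s1 * s)" unfolding sq S_def by algebra
    finally show ?thesis using S by simp
  qed
  have ds: "D * F * Fs - b * G * Gs = 0"
  proof -
    have "2 * (D * F * Fs - b * G * Gs) = (2 * D * f2 * f1 - 2 * b * h2 * h1) * r ^ 3
      + 2 * (D * (f1\<^sup>2 + 2 * f2 * f0) - b * (h1\<^sup>2 + 2 * h2 * h0)) * r\<^sup>2 * s
      + 3 * (2 * D * f1 * f0 - 2 * b * h1 * h0) * r * s\<^sup>2 + 4 * (D * f0\<^sup>2 - b * h0\<^sup>2) * s ^ 3"
      unfolding F_def G_def Fs_def Gs_def by algebra
    also have "\<dots> = 2 * S * (s1 * r + 2 * s0 * s)" unfolding sq S_def by algebra
    finally show ?thesis using S by simp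
  qed
  define N B q where "N = bin_polar P Q R m0 n0 m0 n0" and "B = bin_polar P Q R m0 n0 r s"
    and "q = bin_polar P Q R r s r s"
  have FG: "F = 2 * B * r - q * m0" "G = 2 * B * s - q * n0"
    unfolding F_def G_def B_def q_def bin_polar_def f h by algebra+
  have jac: "Fr * Gs - Fs * Gr = 4 * N * q"
    unfolding Fr_def Fs_def Gr_def Gs_def N_def q_def bin_polar_def f h by algebra
  have "D * F * (Fr * Gs - Fs * Gr) = 0" "b * G * (Fr * Gs - Fs * Gr) = 0"
    using dr ds by algebra+
  hence "q = 0 \<or> (F = 0 \<and> G = 0)" unfolding jac using nz aniso by (auto simp: N_def)
  moreover have "bin_polar P Q R F G F G = N * q\<^sup>2"
    unfolding FG unfolding N_def q_def B_def bin_polar_def by algebra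
  ultimately have q: "q = 0" using aniso by (auto simp: N_def bin_polar_def)
  have B: "B \<noteq> 0"
  proof
    assume "B = 0"
    have "(P * R - Q\<^sup>2) * (m0 * s - n0 * r)\<^sup>2 = N * q - B\<^sup>2"
      unfolding N_def q_def B_def bin_polar_def by algebra
    hence \<delta>: "m0 * s - n0 * r = 0" using det q \<open>B = 0\<close> by simp
    have "N * r = m0 * B - (Q * m0 + R * n0) * (m0 * s - n0 * r)"
      "N * s = n0 * B + (P * m0 + Q * n0) * (m0 * s - n0 * r)"
      unfolding N_def B_def bin_polar_def by algebra+
    thus False using \<delta> \<open>B = 0\<close> aniso rs(1) by (auto simp: N_def)
  qed
  have "4 * B\<^sup>2 * (D * r\<^sup>2 - b * s\<^sup>2) = 0" using val unfolding FG q by algebra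
  hence norm: "D * r\<^sup>2 - b * s\<^sup>2 = 0" using B by simp
  \<comment> \<open>so \<open>(r, s)\<close> would be a common root of the two binary forms, which is impossible\<close>
  have "2 * D * (r * (D * z0 * r - b * y0 * s)) = (D * z0 + d1 * x0) * (D * r\<^sup>2 - b * s\<^sup>2) + q"
    unfolding q_def bin_polar_def PQR by algebra
  hence r: "r = 0 \<or> D * z0 * r = b * y0 * s" using norm q nz by simp
  have "D * r\<^sup>2 * (D * z0\<^sup>2 - b * y0\<^sup>2) = 0" using r
  proof
    assume "D * z0 * r = b * y0 * s"
    thus ?thesis using norm by algebra
  qed simp
  hence "r = 0" unfolding conic using nz by simp
  thus False using norm nz rs(1) by simp
qed

section \<open>From solutions of the system to quartic equations\<close>

text \<open>
  All quantities of the construction are polynomially bounded in the size \<open>X\<close> of the data.  Since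
  \<open>X \<ge> 2\<close>, constants can be absorbed into the exponent, and exponents add up mechanically along the
  structure of a term.
\<close>

definition pow_bdd :: "int \<Rightarrow> nat \<Rightarrow> int \<Rightarrow> bool" where
  "pow_bdd X k t \<longleftrightarrow> 2 \<le> X \<and> \<bar>t\<bar> \<le> X ^ k"

lemma pow_bdd_mono: "pow_bdd X k t \<Longrightarrow> k \<le> l \<Longrightarrow> pow_bdd X l t"
  unfolding pow_bdd_def by (auto intro: order_trans power_increasing)

lemma pow_bdd_mono_base: "pow_bdd X k t \<Longrightarrow> X \<le> Y \<Longrightarrow> pow_bdd Y k t"
  unfolding pow_bdd_def using power_mono[of X Y k] by auto

lemma pow_bdd_abs_le: "pow_bdd X k t \<Longrightarrow> \<bar>s\<bar> \<le> \<bar>t\<bar> \<Longrightarrow> pow_bdd X k s"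
  unfolding pow_bdd_def by auto

lemma pow_bdd_add:
  assumes "pow_bdd X k s" "pow_bdd X l t"
  shows "pow_bdd X (Suc (k + l)) (s + t)"
proof -
  have X: "2 \<le> X" using assms by (simp add: pow_bdd_def)
  have "X ^ k \<le> X ^ (k + l)" "X ^ l \<le> X ^ (k + l)" using X by (simp_all add: power_increasing)
  hence "\<bar>s\<bar> \<le> X ^ (k + l)" "\<bar>t\<bar> \<le> X ^ (k + l)"
    using assms by (auto simp: pow_bdd_def intro: order_trans)
  hence "\<bar>s + t\<bar> \<le> 2 * X ^ (k + l)" by linarith
  also have "\<dots> \<le> X * X ^ (k + l)" using X by (intro mult_right_mono) auto
  finally show ?thesis using X by (simp add: pow_bdd_def)
qed

lemma pow_bdd_uminus: "pow_bdd X k t \<Longrightarrow> pow_bdd X k (- t)"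
  by (simp add: pow_bdd_def)

lemma pow_bdd_diff: "pow_bdd X k s \<Longrightarrow> pow_bdd X l t \<Longrightarrow> pow_bdd X (Suc (k + l)) (s - t)"
  using pow_bdd_add[OF _ pow_bdd_uminus, of X k s l t] by simp

lemma pow_bdd_mult: "pow_bdd X k s \<Longrightarrow> pow_bdd X l t \<Longrightarrow> pow_bdd X (k + l) (s * t)"
  unfolding pow_bdd_def by (auto simp: abs_mult power_add intro: mult_mono)

lemma pow_bdd_power: "pow_bdd X k t \<Longrightarrow> pow_bdd X (k * n) (t ^ n)"
  unfolding pow_bdd_def by (auto simp: power_abs power_mult intro: power_mono)

lemma pow_bdd_2: "2 \<le> X \<Longrightarrow> pow_bdd X 1 2"
  by (simp add: pow_bdd_def)

lemmas pow_bdd_intros =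
  pow_bdd_add pow_bdd_diff pow_bdd_uminus pow_bdd_mult pow_bdd_power pow_bdd_2

lemma conic_point_pow_bdd:
  fixes P Q R A m n x :: int
  assumes C: "pow_bdd X k P" "pow_bdd X k Q" "pow_bdd X k R" "pow_bdd X k A"
    and det: "P * R - Q\<^sup>2 \<noteq> 0"
    and zero: "bin_polar P Q R m n m n = A * x\<^sup>2" "(m, n) \<noteq> (0, 0)"
  obtains m0 n0 x0 where "bin_polar P Q R m0 n0 m0 n0 = A * x0\<^sup>2" "x0 \<noteq> 0"
    "pow_bdd X (3 * k + 11) m0" "pow_bdd X (3 * k + 11) n0" "pow_bdd X (3 * k + 11) x0"
proof -
  have X: "2 \<le> X" using C by (simp add: pow_bdd_def)
  have "6 * X ^ k * (16 * X ^ k)\<^sup>2 = 1536 * X ^ (3 * k)"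
    by (simp add: power_mult_distrib power2_eq_square power_mult mult.commute power3_eq_cube flip: power_mult)
      (simp add: power_mult power3_eq_cube mult.commute)
  also have "\<dots> \<le> X ^ 11 * X ^ (3 * k)"
    using power_mono[of 2 X 11] X by (intro mult_right_mono) auto
  finally have le: "6 * X ^ k * (16 * X ^ k)\<^sup>2 \<le> X ^ (3 * k + 11)" by (simp add: power_add mult.commute)
  have X1: "1 \<le> X ^ k" using X by (simp add: one_le_power)
  have C': "\<bar>P\<bar> \<le> X ^ k" "\<bar>Q\<bar> \<le> X ^ k" "\<bar>R\<bar> \<le> X ^ k" "\<bar>A\<bar> \<le> X ^ k"
    using C by (simp_all add: pow_bdd_def)
  show thesis
    by (rule conic_point[OF X1 C' det zero], rule that) (use le X in \<open>auto simp: pow_bdd_def\<close>)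
qed

lemma dvd_pow_bdd: "pow_bdd X k t \<Longrightarrow> s dvd t \<Longrightarrow> t \<noteq> 0 \<Longrightarrow> pow_bdd X k s"
  by (erule pow_bdd_abs_le) (use dvd_imp_le_int in auto)

lemma abs_le_abs_mult: "c \<noteq> 0 \<Longrightarrow> \<bar>t\<bar> \<le> \<bar>c * t\<bar>" for c t :: int
  by (auto simp: abs_mult mult_le_cancel_right1)

lemma pow_bdd_factor: "pow_bdd X k (c * t) \<Longrightarrow> c \<noteq> 0 \<Longrightarrow> pow_bdd X k t"
  by (erule pow_bdd_abs_le) (rule abs_le_abs_mult)

text \<open>
  Two conics are parametrized in succession.  The second equation says that \<open>(z, y)\<close> lies on
  \<open>D z\<^sup>2 - b y\<^sup>2 = d2 w\<^sup>2\<close> with \<open>w = 1\<close>.  In terms of the coprime parameters \<open>(r, s)\<close> the coordinate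
  \<open>w\<close> is proportional to \<open>D r\<^sup>2 - b s\<^sup>2\<close>, which therefore is a bounded number \<open>k\<close>, while \<open>z\<close> is a
  quadratic form in \<open>r, s\<close> divided by a bounded number.  Homogenizing the constant \<open>d1\<close> by means of
  \<open>k = D r\<^sup>2 - b s\<^sup>2\<close> turns the first equation into a second conic \<open>q(r, s) = A x\<^sup>2\<close>, whose
  discriminant is a nonzero multiple of \<open>D d2 - d1\<^sup>2\<close>.  Its parametrization expresses \<open>\<nu> r\<close> and
  \<open>\<nu> s\<close>, with \<open>\<nu>\<close> bounded, as quadratic forms in \<open>u, v\<close>, and inserting them into
  \<open>D r\<^sup>2 - b s\<^sup>2 = k\<close> gives a quartic equation with right-hand side \<open>\<nu>\<^sup>2 k\<close>.

  Conversely \<open>u, v\<close> bound \<open>r, s\<close>, then \<open>z, y\<close>, and finally \<open>x\<close>.  The exponents are generous upper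
  bounds for those that the construction produces; only their existence matters.
\<close>

proposition thue_equation_of_solution:
  fixes X a b d1 d2 D x y z :: int
  assumes bdd: "pow_bdd X 1 a" "pow_bdd X 1 b" "pow_bdd X 1 d1" "pow_bdd X 1 d2" "pow_bdd X 1 D"
    and nz: "a \<noteq> 0" "b \<noteq> 0" "d2 \<noteq> 0" "D \<noteq> 0" "d1\<^sup>2 \<noteq> D * d2"
    and sys: "D * z = a * x\<^sup>2 + d1" "D * z\<^sup>2 = b * y\<^sup>2 + d2"
  obtains c0 c1 c2 c3 c4 d m n where
    "pow_bdd X 40000 c0" "pow_bdd X 40000 c1" "pow_bdd X 40000 c2" "pow_bdd X 40000 c3"
    "pow_bdd X 40000 c4" "pow_bdd X 40000 d"
    "d * square_obstruction c0 c1 c2 c3 c4 \<noteq> 0"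
    "c4 * m ^ 4 + c3 * m ^ 3 * n + c2 * m\<^sup>2 * n\<^sup>2 + c1 * m * n ^ 3 + c0 * n ^ 4 = d"
    "pow_bdd (X + \<bar>m\<bar> + \<bar>n\<bar>) 40000 x" "pow_bdd (X + \<bar>m\<bar> + \<bar>n\<bar>) 40000 y"
    "pow_bdd (X + \<bar>m\<bar> + \<bar>n\<bar>) 40000 z"
proof -
  have X: "2 \<le> X" using bdd by (simp add: pow_bdd_def)
  have zero1: "bin_polar D 0 (- b) z y z y = d2 * 1\<^sup>2"
    using sys(2) by (simp add: bin_polar_def power2_eq_square)
  have zy: "(z, y) \<noteq> (0, 0)" using sys(2) nz by auto
  have det1: "D * (- b) - 0\<^sup>2 \<noteq> 0" using nz by simp
  have "pow_bdd X 1 0" "pow_bdd X 1 (- b)" using bdd(2) X by (simp_all add: pow_bdd_def)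
  then obtain z0 y0 x0' where p1: "bin_polar D 0 (- b) z0 y0 z0 y0 = d2 * x0'\<^sup>2" "x0' \<noteq> 0"
    "pow_bdd X 14 z0" "pow_bdd X 14 y0" "pow_bdd X 14 x0'"
    using conic_point_pow_bdd[OF bdd(5) _ _ bdd(4) det1 zero1 zy] by auto
  \<comment> \<open>first conic: the solution itself, with last coordinate 1\<close>
  obtain e r s \<mu> where e: "e = 1 \<or> e = -1" and rs: "coprime r s" and \<mu>: "\<mu> \<noteq> 0"
    and eq1: "gcd z y * refl1 D 0 (- b) z0 y0 r s = \<mu> * z" "gcd z y * refl2 D 0 (- b) z0 y0 r s = \<mu> * y"
    "gcd z y * bin_polar D 0 (- b) r s r s * (e * x0') = \<mu> * 1"
    and \<mu>_dvd: "\<mu> dvd 2 * (D * (- b) - 0\<^sup>2) * (d2 * x0'\<^sup>2) ^ 5"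
    using conic_parametrization[OF p1(1,2) nz(3) det1 zero1 zy] by metis
  define x0 k where "x0 = e * x0'" and "k = bin_polar D 0 (- b) r s r s"
  have x0: "x0 \<noteq> 0" "pow_bdd X 14 x0" "x0\<^sup>2 = x0'\<^sup>2"
    using e p1 by (auto simp: x0_def pow_bdd_def)
  have conic: "D * z0\<^sup>2 - b * y0\<^sup>2 = d2 * x0\<^sup>2"
    using p1(1) x0(3) by (simp add: bin_polar_def power2_eq_square)
  have k: "k = D * r\<^sup>2 - b * s\<^sup>2" by (simp add: k_def bin_polar_def power2_eq_square)
  have "pow_bdd X 148 (2 * (D * (- b) - 0\<^sup>2) * (d2 * x0'\<^sup>2) ^ 5)"
    unfolding zero_power2 diff_0_right by (rule pow_bdd_mono, (rule pow_bdd_intros bdd p1(3-) X)+, simp)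
  moreover have "2 * (D * (- b) - 0\<^sup>2) * (d2 * x0'\<^sup>2) ^ 5 \<noteq> 0" using nz p1(2) by simp
  ultimately have "pow_bdd X 148 \<mu>" using \<mu>_dvd dvd_pow_bdd by blast
  moreover have "k dvd \<mu>" using eq1(3) by (metis dvd_def k_def mult.assoc mult.commute mult.right_neutral)
  ultimately have kb: "pow_bdd X 148 k" using \<mu> by (rule dvd_pow_bdd)
  have k0: "k \<noteq> 0" using eq1(3) \<mu> by (auto simp: k_def)
  have \<gamma>0: "gcd z y \<noteq> 0" using zy by auto
  have zk: "z * (k * x0) = refl1 D 0 (- b) z0 y0 r s" "y * (k * x0) = refl2 D 0 (- b) z0 y0 r s"
  proof -
    have "gcd z y * (z * (k * x0)) = gcd z y * refl1 D 0 (- b) z0 y0 r s"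
      "gcd z y * (y * (k * x0)) = gcd z y * refl2 D 0 (- b) z0 y0 r s"
      using eq1 unfolding k_def[symmetric] x0_def by algebra+
    thus "z * (k * x0) = refl1 D 0 (- b) z0 y0 r s" "y * (k * x0) = refl2 D 0 (- b) z0 y0 r s"
      using \<gamma>0 unfolding mult_cancel_left by blast+
  qed
  \<comment> \<open>second conic: the first equation multiplied by \<open>k x0\<close> and homogenized in \<open>r, s\<close>\<close>
  define P Q R A where "P = D\<^sup>2 * z0 - d1 * x0 * D" and "Q = - b * D * y0"
    and "R = D * b * z0 + d1 * x0 * b" and "A = a * x0 * k"
  have zero2: "bin_polar P Q R r s r s = A * x\<^sup>2"
  proof -
    have "bin_polar P Q R r s r s = D * refl1 D 0 (- b) z0 y0 r s - d1 * x0 * k"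
      unfolding P_def Q_def R_def refl1_def bin_polar_def k by algebra
    also have "\<dots> = A * x\<^sup>2" unfolding zk(1)[symmetric] A_def using sys(1) by algebra
    finally show ?thesis .
  qed
  have det: "P * R - Q\<^sup>2 = D * b * x0\<^sup>2 * (D * d2 - d1\<^sup>2)"
    unfolding P_def Q_def R_def using conic by algebra
  hence det2: "P * R - Q\<^sup>2 \<noteq> 0" using nz x0(1) by simp
  have A0: "A \<noteq> 0" using nz x0 k0 by (simp add: A_def)
  have rs0: "(r, s) \<noteq> (0, 0)" using rs by auto
  have PQR: "pow_bdd X 33 P" "pow_bdd X 33 Q" "pow_bdd X 33 R" "pow_bdd X 163 A"
    unfolding P_def Q_def R_def A_def
    by (rule pow_bdd_mono, (rule pow_bdd_intros bdd p1(3-) x0 kb)+, simp)+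
  have PQR': "pow_bdd X 163 P" "pow_bdd X 163 Q" "pow_bdd X 163 R"
    using PQR by (simp_all add: pow_bdd_mono)
  obtain m0 n0 t0 where p2: "bin_polar P Q R m0 n0 m0 n0 = A * t0\<^sup>2" "t0 \<noteq> 0"
    "pow_bdd X 500 m0" "pow_bdd X 500 n0" "pow_bdd X 500 t0"
    using conic_point_pow_bdd[OF PQR' PQR(4) det2 zero2 rs0] by auto
  obtain u v \<nu> where \<nu>: "\<nu> \<noteq> 0"
    and eq2: "gcd r s * refl1 P Q R m0 n0 u v = \<nu> * r" "gcd r s * refl2 P Q R m0 n0 u v = \<nu> * s"
    and \<nu>_dvd: "\<nu> dvd 2 * (P * R - Q\<^sup>2) * (A * t0\<^sup>2) ^ 5"
    using conic_parametrization[OF p2(1,2) A0 det2 zero2 rs0] by metis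
  have eq2: "refl1 P Q R m0 n0 u v = \<nu> * r" "refl2 P Q R m0 n0 u v = \<nu> * s"
    using eq2 rs by simp_all
  have "pow_bdd X 6000 (2 * (P * R - Q\<^sup>2) * (A * t0\<^sup>2) ^ 5)"
    by (rule pow_bdd_mono, (rule pow_bdd_intros PQR p2(3-) X)+, simp)
  moreover have "2 * (P * R - Q\<^sup>2) * (A * t0\<^sup>2) ^ 5 \<noteq> 0" using det2 A0 p2(2) by simp
  ultimately have \<nu>b: "pow_bdd X 6000 \<nu>" using \<nu>_dvd dvd_pow_bdd by blast
  define f2 f1 f0 h2 h1 h0 where f: "f2 = P * m0 + 2 * Q * n0" "f1 = 2 * R * n0" "f0 = - R * m0"
    and h: "h2 = - P * n0" "h1 = 2 * P * m0" "h0 = 2 * Q * m0 + R * n0"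
  have F: "refl1 P Q R m0 n0 u v = f2 * u\<^sup>2 + f1 * u * v + f0 * v\<^sup>2"
    "refl2 P Q R m0 n0 u v = h2 * u\<^sup>2 + h1 * u * v + h0 * v\<^sup>2"
    unfolding refl1_def refl2_def bin_polar_def f h by algebra+
  have fh: "pow_bdd X 1100 f2" "pow_bdd X 1100 f1" "pow_bdd X 1100 f0"
    "pow_bdd X 1100 h2" "pow_bdd X 1100 h1" "pow_bdd X 1100 h0"
    unfolding f h by (rule pow_bdd_mono, (rule pow_bdd_intros PQR p2(3-) X)+, simp)+
  define c4 c3 c2 c1 c0 where c: "c4 = D * f2\<^sup>2 - b * h2\<^sup>2" "c3 = 2 * D * f2 * f1 - 2 * b * h2 * h1"
    "c2 = D * (f1\<^sup>2 + 2 * f2 * f0) - b * (h1\<^sup>2 + 2 * h2 * h0)"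
    "c1 = 2 * D * f1 * f0 - 2 * b * h1 * h0" "c0 = D * f0\<^sup>2 - b * h0\<^sup>2"
  have cb: "pow_bdd X 40000 c0" "pow_bdd X 40000 c1" "pow_bdd X 40000 c2" "pow_bdd X 40000 c3"
    "pow_bdd X 40000 c4"
    unfolding c by (rule pow_bdd_mono, (rule pow_bdd_intros bdd fh X)+, simp)+
  have db: "pow_bdd X 40000 (\<nu>\<^sup>2 * k)"
    by (rule pow_bdd_mono, (rule pow_bdd_intros \<nu>b kb)+, simp)
  have val: "c4 * u ^ 4 + c3 * u ^ 3 * v + c2 * u\<^sup>2 * v\<^sup>2 + c1 * u * v ^ 3 + c0 * v ^ 4 = \<nu>\<^sup>2 * k"
  proof -
    have "c4 * u ^ 4 + c3 * u ^ 3 * v + c2 * u\<^sup>2 * v\<^sup>2 + c1 * u * v ^ 3 + c0 * v ^ 4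
      = D * (f2 * u\<^sup>2 + f1 * u * v + f0 * v\<^sup>2)\<^sup>2 - b * (h2 * u\<^sup>2 + h1 * u * v + h0 * v\<^sup>2)\<^sup>2"
      unfolding c by algebra
    also have "\<dots> = D * (\<nu> * r)\<^sup>2 - b * (\<nu> * s)\<^sup>2" unfolding F[symmetric] eq2 ..
    also have "\<dots> = \<nu>\<^sup>2 * k" unfolding k by algebra
    finally show ?thesis .
  qed
  have "square_obstruction c0 c1 c2 c3 c4 \<noteq> 0"
  proof
    let ?c = "of_int :: int \<Rightarrow> complex"
    assume "square_obstruction c0 c1 c2 c3 c4 = 0"
    then obtain s0 s1 s2 :: complex where sq: "?c c4 = s2\<^sup>2" "?c c3 = 2 * s2 * s1"
      "?c c2 = s1\<^sup>2 + 2 * s2 * s0" "?c c1 = 2 * s1 * s0" "?c c0 = s0\<^sup>2"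
      unfolding square_obstruction_eq_0_iff by blast
    show False
    proof (rule composed_quartic_not_square[where D = "?c D" and b = "?c b" and ?d1.0 = "?c d1" and ?d2.0 = "?c d2"
        and ?z0.0 = "?c z0" and ?y0.0 = "?c y0" and ?x0.0 = "?c x0" and P = "?c P" and Q = "?c Q" and R = "?c R"
        and ?m0.0 = "?c m0" and ?n0.0 = "?c n0" and ?f0.0 = "?c f0" and ?f1.0 = "?c f1" and ?f2.0 = "?c f2"
        and ?h0.0 = "?c h0" and ?h1.0 = "?c h1" and ?h2.0 = "?c h2"])
      show "?c D * (?c z0)\<^sup>2 - ?c b * (?c y0)\<^sup>2 = ?c d2 * (?c x0)\<^sup>2"
        using arg_cong[OF conic, of ?c] by simp
      show "?c P * ?c R - (?c Q)\<^sup>2 \<noteq> 0"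
        using det2 by (simp flip: of_int_mult of_int_power of_int_diff)
      have "bin_polar P Q R m0 n0 m0 n0 \<noteq> 0" using p2 A0 by simp
      thus "bin_polar (?c P) (?c Q) (?c R) (?c m0) (?c n0) (?c m0) (?c n0) \<noteq> 0"
        unfolding bin_polar_def by (simp flip: of_int_mult of_int_add)
      show "?c D * (?c f2)\<^sup>2 - ?c b * (?c h2)\<^sup>2 = s2\<^sup>2"
        "2 * ?c D * ?c f2 * ?c f1 - 2 * ?c b * ?c h2 * ?c h1 = 2 * s2 * s1"
        "?c D * ((?c f1)\<^sup>2 + 2 * ?c f2 * ?c f0) - ?c b * ((?c h1)\<^sup>2 + 2 * ?c h2 * ?c h0) = s1\<^sup>2 + 2 * s2 * s0"
        "2 * ?c D * ?c f1 * ?c f0 - 2 * ?c b * ?c h1 * ?c h0 = 2 * s1 * s0"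
        "?c D * (?c f0)\<^sup>2 - ?c b * (?c h0)\<^sup>2 = s0\<^sup>2"
        using sq unfolding c by simp_all
    qed (use nz x0(1) in \<open>simp_all add: P_def Q_def R_def f h\<close>)
  qed
  hence ob: "\<nu>\<^sup>2 * k * square_obstruction c0 c1 c2 c3 c4 \<noteq> 0" using \<nu> k0 by simp
  define Y where "Y = X + \<bar>u\<bar> + \<bar>v\<bar>"
  have XY: "X \<le> Y" by (simp add: Y_def)
  have Y: "2 \<le> Y" using X XY by simp
  have uv: "pow_bdd Y 1 u" "pow_bdd Y 1 v" using X by (simp_all add: pow_bdd_def Y_def)
  note toY = pow_bdd_mono_base[OF _ XY]
  have Fb: "pow_bdd Y 3400 (refl1 P Q R m0 n0 u v)" "pow_bdd Y 3400 (refl2 P Q R m0 n0 u v)"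
    unfolding F by (rule pow_bdd_mono, (rule pow_bdd_intros toY[OF fh(1)] toY[OF fh(2)] toY[OF fh(3)]
      toY[OF fh(4)] toY[OF fh(5)] toY[OF fh(6)] uv)+, simp)+
  have rsb: "pow_bdd Y 3400 r" "pow_bdd Y 3400 s"
    using Fb pow_bdd_factor[of Y 3400 \<nu>] \<nu> unfolding eq2 by simp_all
  note bY = toY[OF bdd(1)] toY[OF bdd(2)] toY[OF bdd(3)] toY[OF bdd(4)] toY[OF bdd(5)]
    toY[OF p1(3)] toY[OF p1(4)]
  have "refl1 D 0 (- b) z0 y0 r s = D * z0 * r\<^sup>2 - 2 * b * y0 * r * s + b * z0 * s\<^sup>2"
    "refl2 D 0 (- b) z0 y0 r s = 2 * D * z0 * r * s - b * y0 * s\<^sup>2 - D * y0 * r\<^sup>2"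
    unfolding refl1_def refl2_def bin_polar_def by algebra+
  moreover have "pow_bdd Y 30000 (D * z0 * r\<^sup>2 - 2 * b * y0 * r * s + b * z0 * s\<^sup>2)"
    "pow_bdd Y 30000 (2 * D * z0 * r * s - b * y0 * s\<^sup>2 - D * y0 * r\<^sup>2)"
    by (rule pow_bdd_mono, (rule pow_bdd_intros bY rsb Y)+, simp)+
  ultimately have "pow_bdd Y 30000 (k * x0 * z)" "pow_bdd Y 30000 (k * x0 * y)"
    using zk by (simp_all add: mult_ac)
  hence zb: "pow_bdd Y 30000 z" "pow_bdd Y 30000 y"
    using pow_bdd_factor[of Y 30000 "k * x0"] k0 x0(1) by simp_all
  have "pow_bdd Y 40000 (D * z - d1)"
    by (rule pow_bdd_mono, (rule pow_bdd_intros bY zb)+, simp)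
  moreover have "\<bar>x\<bar> \<le> \<bar>D * z - d1\<bar>"
  proof -
    have "\<bar>x\<bar> \<le> \<bar>x * x\<bar>" using abs_le_abs_mult[of x x] by (cases "x = 0") auto
    also have "\<dots> \<le> \<bar>a * x\<^sup>2\<bar>" using abs_le_abs_mult[OF nz(1), of "x\<^sup>2"] by (simp add: power2_eq_square)
    also have "a * x\<^sup>2 = D * z - d1" using sys(1) by simp
    finally show ?thesis .
  qed
  ultimately have xb: "pow_bdd Y 40000 x" by (rule pow_bdd_abs_le)
  have "pow_bdd Y 40000 y" "pow_bdd Y 40000 z" using zb by (auto elim: pow_bdd_mono)
  with cb db ob val xb show thesis unfolding Y_def by (rule that)
qed

section \<open>Recursive functions\<close>

text \<open>
  Recursiveness up to equality on argument lists of length \<open>k\<close>.  Modulo this equality the class is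
  closed under the usual schemes in pointwise form.
\<close>

definition rec_fun :: "nat \<Rightarrow> (nat list \<Rightarrow> nat) \<Rightarrow> bool" where
  "rec_fun k f \<longleftrightarrow> (\<exists>h. recursive k h \<and> (\<forall>xs. length xs = k \<longrightarrow> h xs = f xs))"

lemma rec_fun_cong: "rec_fun k f \<Longrightarrow> (\<And>xs. length xs = k \<Longrightarrow> f xs = g xs) \<Longrightarrow> rec_fun k g"
  unfolding rec_fun_def by metis

lemma recursive_imp_rec_fun: "recursive k f \<Longrightarrow> rec_fun k f"
  unfolding rec_fun_def by blast

lemma rec_fun_proj: "i < k \<Longrightarrow> rec_fun k (\<lambda>xs. xs ! i)"
  by (rule recursive_imp_rec_fun[OF recursive.proj])

lemma rec_fun_comp:
  assumes f: "rec_fun (length gs) f" and gs: "\<And>g. g \<in> set gs \<Longrightarrow> rec_fun k g"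
  shows "rec_fun k (\<lambda>xs. f (map (\<lambda>g. g xs) gs))"
proof -
  obtain hf where hf: "recursive (length gs) hf" "\<And>xs. length xs = length gs \<Longrightarrow> hf xs = f xs"
    using f unfolding rec_fun_def by blast
  obtain h where h: "\<And>g. g \<in> set gs \<Longrightarrow> recursive k (h g) \<and> (\<forall>xs. length xs = k \<longrightarrow> h g xs = g xs)"
    using gs unfolding rec_fun_def by metis
  have "recursive k (\<lambda>xs. hf (map (\<lambda>g. g xs) (map h gs)))"
    by (rule recursive.comp) (use hf h in auto)
  moreover have "hf (map (\<lambda>g. g xs) (map h gs)) = f (map (\<lambda>g. g xs) gs)" if "length xs = k" for xs
  proof -
    have "map (\<lambda>g. g xs) (map h gs) = map (\<lambda>g. g xs) gs" using h that by simp
    thus ?thesis using hf(2) by (metis length_map)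
  qed
  ultimately show ?thesis unfolding rec_fun_def by blast
qed

lemma rec_fun_drop:
  assumes "rec_fun k f"
  shows "rec_fun (j + k) (\<lambda>ys. f (drop j ys))"
proof -
  let ?gs = "map (\<lambda>i ys. ys ! (j + i)) [0..<k]"
  have "rec_fun (j + k) (\<lambda>ys. f (map (\<lambda>g. g ys) ?gs))"
    by (rule rec_fun_comp) (use assms in \<open>auto intro: rec_fun_proj\<close>)
  moreover have "map (\<lambda>g. g ys) ?gs = drop j ys" if "length ys = j + k" for ys :: "nat list"
    by (rule nth_equalityI) (use that in auto)
  ultimately show ?thesis by (auto elim: rec_fun_cong)
qed

lemma rec_fun_rec_nat:
  assumes F: "rec_fun k F" and G: "rec_fun (2 + k) G" and H: "rec_fun k H"
  shows "rec_fun k (\<lambda>xs. rec_nat (F xs) (\<lambda>n r. G (n # r # xs)) (H xs))"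
proof -
  obtain hF hG where hF: "recursive k hF" "\<And>xs. length xs = k \<Longrightarrow> hF xs = F xs"
    and hG: "recursive (2 + k) hG" "\<And>xs. length xs = 2 + k \<Longrightarrow> hG xs = G xs"
    using F G unfolding rec_fun_def by blast
  let ?P = "\<lambda>xs. rec_nat (hF (tl xs)) (\<lambda>n r. hG (n # r # tl xs)) (hd xs)"
  let ?gs = "H # map (\<lambda>i xs. xs ! i) [0..<k]"
  have "recursive (Suc k) ?P" by (rule recursive.prec) (use hF hG in simp_all)
  hence "rec_fun (length ?gs) ?P" by (simp add: recursive_imp_rec_fun)
  hence "rec_fun k (\<lambda>xs. ?P (map (\<lambda>g. g xs) ?gs))"
    by (rule rec_fun_comp) (use H in \<open>auto intro: rec_fun_proj\<close>)
  moreover have "?P (map (\<lambda>g. g xs) ?gs) = rec_nat (F xs) (\<lambda>n r. G (n # r # xs)) (H xs)"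
    if "length xs = k" for xs
  proof -
    have "map (\<lambda>g. g xs) ?gs = H xs # xs"
      using that map_nth[of xs] by (simp add: comp_def)
    thus ?thesis using that by (simp add: hF hG)
  qed
  ultimately show ?thesis by (rule rec_fun_cong)
qed

lemma rec_fun_Least:
  assumes f: "rec_fun (Suc k) f" and ex: "\<And>xs. length xs = k \<Longrightarrow> \<exists>n. f (n # xs) = 0"
  shows "rec_fun k (\<lambda>xs. LEAST n. f (n # xs) = 0)"
proof -
  obtain h where h: "recursive (Suc k) h" "\<And>xs. length xs = Suc k \<Longrightarrow> h xs = f xs"
    using f unfolding rec_fun_def by blast
  have "recursive k (\<lambda>xs. LEAST n. h (n # xs) = 0)"
    by (rule recursive.mini) (use h ex in auto)
  thus ?thesis by (rule rec_fun_cong[OF recursive_imp_rec_fun]) (simp add: h)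
qed

lemma rec_fun_Suc:
  assumes "rec_fun k f" shows "rec_fun k (\<lambda>xs. Suc (f xs))"
proof -
  have "rec_fun k (\<lambda>xs. (\<lambda>xs. Suc (xs ! 0)) (map (\<lambda>g. g xs) [f]))"
    by (rule rec_fun_comp) (use assms recursive.succ in \<open>auto intro: recursive_imp_rec_fun\<close>)
  thus ?thesis by simp
qed

lemma rec_fun_const: "rec_fun k (\<lambda>_. c)"
  by (induction c) (auto intro: rec_fun_Suc recursive_imp_rec_fun recursive.zero)

lemma rec_fun_if:
  assumes "rec_fun k t" "rec_fun k f" "rec_fun k g"
  shows "rec_fun k (\<lambda>xs. if t xs = 0 then f xs else g xs)"
proof -
  have "rec_fun k (\<lambda>xs. rec_nat (f xs) (\<lambda>n r. (\<lambda>ys. g (drop 2 ys)) (n # r # xs)) (t xs))"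
    by (intro rec_fun_rec_nat rec_fun_drop assms)
  moreover have "rec_nat x (\<lambda>_ _. y) m = (if m = 0 then x else y)" for x y :: nat and m
    by (cases m) auto
  ultimately show ?thesis by simp
qed

lemma rec_fun_add:
  assumes "rec_fun k f" "rec_fun k g" shows "rec_fun k (\<lambda>xs. f xs + g xs)"
proof -
  have "rec_fun k (\<lambda>xs. rec_nat (f xs) (\<lambda>n r. (\<lambda>ys. Suc (ys ! 1)) (n # r # xs)) (g xs))"
    by (intro rec_fun_rec_nat rec_fun_Suc rec_fun_proj assms) simp
  moreover have "rec_nat x (\<lambda>_ r. Suc r) m = x + m" for x m by (induction m) auto
  ultimately show ?thesis by simp
qed

lemma rec_fun_pred:
  assumes "rec_fun k f" shows "rec_fun k (\<lambda>xs. f xs - 1)"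
proof -
  have "rec_fun k (\<lambda>xs. rec_nat 0 (\<lambda>n r. (\<lambda>ys. ys ! 0) (n # r # xs)) (f xs))"
    by (intro rec_fun_rec_nat rec_fun_const rec_fun_proj assms) simp
  moreover have "rec_nat 0 (\<lambda>n _. n) m = m - 1" for m :: nat by (cases m) auto
  ultimately show ?thesis by simp
qed

lemma rec_fun_diff:
  assumes "rec_fun k f" "rec_fun k g" shows "rec_fun k (\<lambda>xs. f xs - g xs)"
proof -
  have "rec_fun k (\<lambda>xs. rec_nat (f xs) (\<lambda>n r. (\<lambda>ys. ys ! 1 - 1) (n # r # xs)) (g xs))"
    by (intro rec_fun_rec_nat rec_fun_pred rec_fun_proj assms) simp
  moreover have "rec_nat x (\<lambda>_ r. r - 1) m = x - m" for x m :: nat by (induction m) auto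
  ultimately show ?thesis by simp
qed

lemma rec_fun_mult:
  assumes "rec_fun k f" "rec_fun k g" shows "rec_fun k (\<lambda>xs. f xs * g xs)"
proof -
  have "rec_fun k (\<lambda>xs. rec_nat 0 (\<lambda>n r. (\<lambda>ys. ys ! 1 + f (drop 2 ys)) (n # r # xs)) (g xs))"
    by (intro rec_fun_rec_nat rec_fun_add rec_fun_drop rec_fun_const rec_fun_proj assms) simp
  moreover have "rec_nat 0 (\<lambda>_ r. r + x) m = x * m" for x m :: nat by (induction m) auto
  ultimately show ?thesis by simp
qed

lemma rec_fun_power: "rec_fun k f \<Longrightarrow> rec_fun k (\<lambda>xs. f xs ^ n)"
  by (induction n) (auto intro: rec_fun_const rec_fun_mult)

lemma rec_fun_triangle:
  assumes "rec_fun k f" shows "rec_fun k (\<lambda>xs. triangle (f xs))"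
proof -
  have "rec_fun k (\<lambda>xs. rec_nat 0 (\<lambda>n r. (\<lambda>ys. ys ! 1 + Suc (ys ! 0)) (n # r # xs)) (f xs))"
    by (intro rec_fun_rec_nat rec_fun_add rec_fun_Suc rec_fun_const rec_fun_proj assms) simp_all
  moreover have "rec_nat 0 (\<lambda>n r. r + Suc n) m = triangle m" for m by (induction m) auto
  ultimately show ?thesis by simp
qed

lemma rec_fun_prod_encode:
  "rec_fun k f \<Longrightarrow> rec_fun k g \<Longrightarrow> rec_fun k (\<lambda>xs. prod_encode (f xs, g xs))"
  unfolding prod_encode_def by (simp add: rec_fun_add rec_fun_triangle)

text \<open>
  The inverse of Cantor pairing: \<open>prod_encode (a, b)\<close> lies on the antidiagonal \<open>a + b\<close>, which is
  found by unbounded search and determines both components.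
\<close>

definition diagonal :: "nat \<Rightarrow> nat" where
  "diagonal m = (LEAST n. Suc m - triangle (Suc n) = 0)"

lemma diagonal_prod_encode: "diagonal (prod_encode (a, b)) = a + b"
  unfolding diagonal_def
proof (rule Least_equality)
  show "Suc (prod_encode (a, b)) - triangle (Suc (a + b)) = 0"
    by (simp add: prod_encode_def)
next
  fix n assume *: "Suc (prod_encode (a, b)) - triangle (Suc n) = 0"
  show "a + b \<le> n"
  proof (rule ccontr)
    assume "\<not> a + b \<le> n"
    hence "Suc n \<le> a + b" by simp
    hence "triangle (Suc n) \<le> triangle (a + b)"
      by (rule lift_Suc_mono_le[where f = triangle, rotated]) simp
    thus False using * by (simp add: prod_encode_def)
  qed
qed

lemma prod_decode_diagonal:
  "fst (prod_decode m) = m - triangle (diagonal m)"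
  "snd (prod_decode m) = diagonal m - (m - triangle (diagonal m))"
proof -
  obtain a b where "prod_decode m = (a, b)" by fastforce
  hence m: "m = prod_encode (a, b)" by (metis prod_decode_inverse)
  have "prod_encode (a, b) - triangle (a + b) = a" by (simp add: prod_encode_def)
  thus "fst (prod_decode m) = m - triangle (diagonal m)"
    "snd (prod_decode m) = diagonal m - (m - triangle (diagonal m))"
    unfolding m diagonal_prod_encode by simp_all
qed

lemma rec_fun_diagonal:
  assumes "rec_fun k f" shows "rec_fun k (\<lambda>xs. diagonal (f xs))"
proof -
  have "rec_fun k (\<lambda>xs. LEAST n. (\<lambda>ys. Suc (f (drop 1 ys)) - triangle (Suc (ys ! 0))) (n # xs) = 0)"
  proof (rule rec_fun_Least)
    show "rec_fun (Suc k) (\<lambda>ys. Suc (f (drop 1 ys)) - triangle (Suc (ys ! 0)))"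
      using rec_fun_drop[OF assms, of 1]
      by (intro rec_fun_diff rec_fun_Suc rec_fun_triangle rec_fun_proj) simp_all
    show "\<exists>n. Suc (f (drop 1 (n # xs))) - triangle (Suc ((n # xs) ! 0)) = 0" for xs
      by (rule exI[of _ "f xs"]) simp
  qed
  thus ?thesis by (simp add: diagonal_def)
qed

lemma rec_fun_fst_prod_decode: "rec_fun k f \<Longrightarrow> rec_fun k (\<lambda>xs. fst (prod_decode (f xs)))"
  unfolding prod_decode_diagonal by (intro rec_fun_diff rec_fun_triangle rec_fun_diagonal)

lemma rec_fun_snd_prod_decode: "rec_fun k f \<Longrightarrow> rec_fun k (\<lambda>xs. snd (prod_decode (f xs)))"
  unfolding prod_decode_diagonal by (intro rec_fun_diff rec_fun_triangle rec_fun_diagonal)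

lemma rec_fun_mod_2:
  assumes "rec_fun k f" shows "rec_fun k (\<lambda>xs. f xs mod 2)"
proof -
  have "rec_fun k (\<lambda>xs. rec_nat 0 (\<lambda>n r. (\<lambda>ys. 1 - ys ! 1) (n # r # xs)) (f xs))"
    by (intro rec_fun_rec_nat rec_fun_diff rec_fun_const rec_fun_proj assms) simp_all
  moreover have "rec_nat 0 (\<lambda>_ r. 1 - r) m = m mod 2" for m :: nat
    by (induction m) (auto simp: mod_Suc)
  ultimately show ?thesis by simp
qed

lemma rec_fun_div_2:
  assumes "rec_fun k f" shows "rec_fun k (\<lambda>xs. f xs div 2)"
proof -
  have "rec_fun k (\<lambda>xs. rec_nat 0 (\<lambda>n r. (\<lambda>ys. ys ! 1 + ys ! 0 mod 2) (n # r # xs)) (f xs))"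
    by (intro rec_fun_rec_nat rec_fun_add rec_fun_mod_2 rec_fun_const rec_fun_proj assms) simp_all
  moreover have "rec_nat 0 (\<lambda>n r. r + n mod 2) m = m div 2" for m :: nat
    by (induction m) (simp_all, presburger)
  ultimately show ?thesis by simp
qed

text \<open>
  Integer-valued functions as differences of recursive ones; in this representation the ring
  operations need no case distinction on signs.
\<close>

definition rec_int_fun :: "nat \<Rightarrow> (nat list \<Rightarrow> int) \<Rightarrow> bool" where
  "rec_int_fun k F \<longleftrightarrow> (\<exists>p n. rec_fun k p \<and> rec_fun k n \<and> (\<forall>xs. F xs = int (p xs) - int (n xs)))"

lemma rec_int_funI:
  "rec_fun k p \<Longrightarrow> rec_fun k n \<Longrightarrow> (\<And>xs. F xs = int (p xs) - int (n xs)) \<Longrightarrow> rec_int_fun k F"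
  unfolding rec_int_fun_def by blast

lemma int_decode_eq:
  "int_decode c = int ((1 - c mod 2) * (c div 2)) - int (c mod 2 * Suc (c div 2))"
  by (auto simp: int_decode_def sum_decode_def elim!: evenE oddE)

lemma rec_int_fun_decode: "rec_fun k f \<Longrightarrow> rec_int_fun k (\<lambda>xs. int_decode (f xs))"
  by (rule rec_int_funI[OF _ _ int_decode_eq])
    (intro rec_fun_mult rec_fun_diff rec_fun_Suc rec_fun_const rec_fun_mod_2 rec_fun_div_2; assumption)+

lemma rec_int_fun_const: "rec_int_fun k (\<lambda>_. c)"
  by (rule rec_int_funI[of _ "\<lambda>_. nat c" "\<lambda>_. nat (- c)"]) (auto intro: rec_fun_const)

lemma rec_int_fun_add:
  assumes "rec_int_fun k F" "rec_int_fun k G" shows "rec_int_fun k (\<lambda>xs. F xs + G xs)"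
proof -
  obtain p n p' n' where "rec_fun k p" "rec_fun k n" "rec_fun k p'" "rec_fun k n'"
    and "\<And>xs. F xs = int (p xs) - int (n xs)" "\<And>xs. G xs = int (p' xs) - int (n' xs)"
    using assms unfolding rec_int_fun_def by blast
  thus ?thesis
    by (intro rec_int_funI[of k "\<lambda>xs. p xs + p' xs" "\<lambda>xs. n xs + n' xs"] rec_fun_add) auto
qed

lemma rec_int_fun_uminus:
  assumes "rec_int_fun k F" shows "rec_int_fun k (\<lambda>xs. - F xs)"
proof -
  obtain p n where "rec_fun k p" "rec_fun k n" "\<And>xs. F xs = int (p xs) - int (n xs)"
    using assms unfolding rec_int_fun_def by blast
  thus ?thesis by (intro rec_int_funI[of k n p]) auto
qed

lemma rec_int_fun_diff: "rec_int_fun k F \<Longrightarrow> rec_int_fun k G \<Longrightarrow> rec_int_fun k (\<lambda>xs. F xs - G xs)"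
  using rec_int_fun_add[OF _ rec_int_fun_uminus, of k F G] by simp

lemma rec_int_fun_mult:
  assumes "rec_int_fun k F" "rec_int_fun k G" shows "rec_int_fun k (\<lambda>xs. F xs * G xs)"
proof -
  obtain p n p' n' where "rec_fun k p" "rec_fun k n" "rec_fun k p'" "rec_fun k n'"
    and FG: "\<And>xs. F xs = int (p xs) - int (n xs)" "\<And>xs. G xs = int (p' xs) - int (n' xs)"
    using assms unfolding rec_int_fun_def by blast
  thus ?thesis
    by (intro rec_int_funI[of k "\<lambda>xs. p xs * p' xs + n xs * n' xs" "\<lambda>xs. p xs * n' xs + n xs * p' xs"]
        rec_fun_add rec_fun_mult) (simp_all add: FG algebra_simps)
qed

lemma rec_int_fun_power: "rec_int_fun k F \<Longrightarrow> rec_int_fun k (\<lambda>xs. F xs ^ n)"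
  by (induction n) (auto intro: rec_int_fun_const rec_int_fun_mult)

lemma rec_fun_if_int:
  assumes "rec_int_fun k F" "rec_fun k f" "rec_fun k g"
  shows "rec_fun k (\<lambda>xs. if F xs = 0 then f xs else g xs)"
proof -
  obtain p n where pn: "rec_fun k p" "rec_fun k n" "\<And>xs. F xs = int (p xs) - int (n xs)"
    using assms unfolding rec_int_fun_def by blast
  have "rec_fun k (\<lambda>xs. if (p xs - n xs) + (n xs - p xs) = 0 then f xs else g xs)"
    by (intro rec_fun_if rec_fun_add rec_fun_diff pn assms)
  thus ?thesis by (rule rec_fun_cong) (auto simp: pn)
qed

lemma computableI:
  "rec_fun 1 (\<lambda>xs. f (xs ! 0)) \<Longrightarrow> (\<And>x. f (enc_in x) = enc_out (F x)) \<Longrightarrow> computable enc_in enc_out F"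
  unfolding computable_def rec_fun_def by force

text \<open>
  Both algorithms of the reduction enumerate all codes below a bound and keep those that decode to
  something admissible.
\<close>

primrec collect :: "(nat \<Rightarrow> 'a option) \<Rightarrow> nat \<Rightarrow> 'a list" where
  "collect t 0 = []"
| "collect t (Suc n) = (case t n of None \<Rightarrow> collect t n | Some x \<Rightarrow> x # collect t n)"

lemma set_collect: "set (collect t n) = {x. \<exists>j<n. t j = Some x}"
  by (induction n) (auto split: option.splits simp: less_Suc_eq)

lemma rec_fun_collect:
  assumes N: "rec_fun 1 (\<lambda>xs. N (xs ! 0))" and e: "rec_fun 1 (\<lambda>xs. e (xs ! 0))"
    and F: "rec_int_fun 1 (\<lambda>xs. F (xs ! 0))"
    and t: "\<And>j. t j = None \<longleftrightarrow> F j = 0" "\<And>j x. t j = Some x \<Longrightarrow> enc x = e j"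
  shows "rec_fun 1 (\<lambda>xs. enc_list enc (collect t (N (xs ! 0))))"
proof -
  let ?G = "\<lambda>ys. if F (ys ! 0) = 0 then ys ! 1 else Suc (prod_encode (e (ys ! 0), ys ! 1))"
  have e3: "rec_fun 3 (\<lambda>ys. e (ys ! 0))"
    using rec_fun_comp[of "[\<lambda>ys. ys ! 0]" "\<lambda>xs. e (xs ! 0)" 3] e by (simp add: rec_fun_proj)
  have F3: "rec_int_fun 3 (\<lambda>ys. F (ys ! 0))"
  proof -
    obtain p n where pn: "rec_fun 1 p" "rec_fun 1 n" "\<And>xs. F (xs ! 0) = int (p xs) - int (n xs)"
      using F unfolding rec_int_fun_def by blast
    have "rec_fun 3 (\<lambda>ys. p [ys ! 0])" "rec_fun 3 (\<lambda>ys. n [ys ! 0])"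
      using rec_fun_comp[of "[\<lambda>ys. ys ! 0]" p 3] rec_fun_comp[of "[\<lambda>ys. ys ! 0]" n 3] pn
      by (simp_all add: rec_fun_proj)
    thus ?thesis using pn(3)[of "[_ ! 0]"] by (intro rec_int_funI) auto
  qed
  have "rec_fun (2 + 1) ?G"
    using e3 F3 by (auto intro!: rec_fun_if_int rec_fun_Suc rec_fun_prod_encode rec_fun_proj)
  hence "rec_fun 1 (\<lambda>xs. rec_nat 0 (\<lambda>n r. ?G (n # r # xs)) (N (xs ! 0)))"
    by (intro rec_fun_rec_nat rec_fun_const N)
  moreover have "rec_nat 0 (\<lambda>n r. ?G (n # r # xs)) m = enc_list enc (collect t m)" for m xs
  proof (induction m)
    case (Suc m)
    thus ?case using t(1)[of m] t(2)[of m] by (cases "t m") (auto simp: enc_list_def)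
  qed (simp add: enc_list_def)
  ultimately show ?thesis by simp
qed

section \<open>The reduction algorithm\<close>

definition quartic_form :: "'a::zero \<Rightarrow> 'a \<Rightarrow> 'a \<Rightarrow> 'a \<Rightarrow> 'a \<Rightarrow> 'a poly poly" where
  "quartic_form c0 c1 c2 c3 c4 =
     [:monom c0 4, monom c1 3, monom c2 2, monom c3 1, monom c4 0:]"

lemma coeff_quartic_form:
  "coeff (coeff (quartic_form c0 c1 c2 c3 c4) i) j =
    (if i + j = 4 then [c0, c1, c2, c3, c4] ! i else 0)"
  by (auto simp: quartic_form_def coeff_pCons' nth_Cons')

lemma eval2_quartic_form:
  "eval2 (quartic_form c0 c1 c2 c3 c4) m n =
    c4 * m ^ 4 + c3 * m ^ 3 * n + c2 * m\<^sup>2 * n\<^sup>2 + c1 * m * n ^ 3 + c0 * n ^ 4"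
  by (simp add: eval2_def quartic_form_def poly_monom algebra_simps eval_nat_numeral)

text \<open>
  A factorization \<open>\<kappa> T\<^sup>2\<close> need not be homogeneous a priori.  Setting \<open>n = 1\<close> turns it into one of a
  polynomial of degree at most four in one variable, whose square root has degree at most two.
\<close>

lemma quartic_thue_like_quartic_form:
  assumes "d * square_obstruction c0 c1 c2 c3 c4 \<noteq> 0"
  shows "quartic_thue_like (quartic_form c0 c1 c2 c3 c4, d)"
proof -
  let ?g = "quartic_form c0 c1 c2 c3 c4" and ?c = "of_int :: int \<Rightarrow> complex"
  have "?g \<noteq> 0"
  proof
    assume "?g = 0"
    hence "coeff (coeff ?g i) (4 - i) = 0" for i by simp
    from this[of 0] this[of 1] this[of 2] this[of 3] this[of 4] assms show False
      by (simp add: coeff_quartic_form square_obstruction_def)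
  qed
  hence hom: "homogeneous 4 ?g" by (auto simp: homogeneous_def coeff_quartic_form)
  have "False" if eq: "of_int_poly2 ?g = smult [:\<kappa>:] (T ^ 2)" for \<kappa> and T :: "complex poly poly"
  proof -
    define G where "G = [:?c c0, ?c c1, ?c c2, ?c c3, ?c c4:]"
    define S where "S = smult (csqrt \<kappa>) (map_poly (\<lambda>p. poly p 1) T)"
    have "poly (map_poly (\<lambda>p. poly p 1) T) x = poly (poly T [:x:]) 1" for x
      by (induction T) (auto simp: map_poly_pCons)
    moreover have "poly G x = poly (poly (of_int_poly2 ?g) [:x:]) 1" for x
      by (simp add: G_def of_int_poly2_def quartic_form_def map_poly_pCons map_poly_monom poly_monom)
    ultimately have "poly G x = poly (S ^ 2) x" for x
      by (simp add: eq S_def power_mult_distrib)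
    hence GS: "G = S ^ 2" by (metis poly_eq_poly_eq_iff ext)
    have "degree G \<le> 4" unfolding G_def by (simp add: degree_pCons_eq_if)
    hence "degree S \<le> 2" unfolding GS by (cases "S = 0") (auto simp: degree_power_eq)
    define s where "s = coeff S"
    have "coeff S i = 0" if "i > 2" for i using that \<open>degree S \<le> 2\<close> by (simp add: coeff_eq_0)
    hence S: "S = [:s 0, s 1, s 2:]"
      by (intro poly_eqI) (auto simp: s_def coeff_pCons split: nat.split simp: numeral_2_eq_2)
    have "?c c4 = (s 2)\<^sup>2 \<and> ?c c3 = 2 * s 2 * s 1 \<and> ?c c2 = (s 1)\<^sup>2 + 2 * s 2 * s 0 \<and>
        ?c c1 = 2 * s 1 * s 0 \<and> ?c c0 = (s 0)\<^sup>2"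
      using GS unfolding G_def S by (simp add: power2_eq_square algebra_simps)
    hence "square_obstruction c0 c1 c2 c3 c4 = 0" unfolding square_obstruction_eq_0_iff by blast
    thus False using assms by simp
  qed
  thus ?thesis using hom assms by (auto simp: quartic_thue_like_def)
qed

text \<open>
  Iterated pairing without length information: every natural number codes a tuple of each length, so
  an enumeration of numbers needs no check for well-formedness.
\<close>

definition tuple_encode :: "nat list \<Rightarrow> nat" where
  "tuple_encode ns = foldr (\<lambda>a r. prod_encode (a, r)) ns 0"

definition entry :: "nat \<Rightarrow> nat \<Rightarrow> nat" where
  "entry i j = fst (prod_decode (((\<lambda>r. snd (prod_decode r)) ^^ i) j))"

lemma entry_tuple_encode: "i < length ns \<Longrightarrow> entry i (tuple_encode ns) = ns ! i"
proof (induction ns arbitrary: i)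
  case (Cons a ns)
  thus ?case
    by (cases i) (auto simp: entry_def tuple_encode_def funpow_swap1 simp del: funpow.simps(2) simp add: funpow_Suc_right)
qed simp

lemma rec_fun_entry: "rec_fun k f \<Longrightarrow> rec_fun k (\<lambda>xs. entry i (f xs))"
proof -
  assume f: "rec_fun k f"
  have "rec_fun k (\<lambda>xs. ((\<lambda>r. snd (prod_decode r)) ^^ i) (f xs))"
    by (induction i) (auto intro: f rec_fun_snd_prod_decode)
  thus ?thesis unfolding entry_def by (rule rec_fun_fst_prod_decode)
qed

lemma prod_encode_le_power:
  fixes U :: nat
  assumes "2 \<le> U" "a \<le> U ^ k" "b \<le> U ^ l"
  shows "prod_encode (a, b) \<le> U ^ (2 * (k + l + 2))"
proof -
  have 1: "U ^ k \<le> U ^ (k + l)" "U ^ l \<le> U ^ (k + l)" "1 \<le> U ^ (k + l)"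
    using assms(1) by (simp_all add: power_increasing)
  have "triangle (a + b) \<le> (a + b) * Suc (a + b)" unfolding triangle_def by simp
  hence "prod_encode (a, b) \<le> (a + b) * Suc (a + b) + a" by (simp add: prod_encode_def)
  also have "\<dots> \<le> (a + b + 1)\<^sup>2" by (simp add: power2_eq_square)
  also have "a + b + 1 \<le> 4 * U ^ (k + l)" using 1 assms by linarith
  hence "(a + b + 1)\<^sup>2 \<le> (4 * U ^ (k + l))\<^sup>2" by (intro power_mono) auto
  also have "\<dots> \<le> (U\<^sup>2 * U ^ (k + l))\<^sup>2"
    using power_mono[of 2 U 2] assms(1) by (intro power_mono mult_right_mono) auto
  also have "\<dots> = U ^ (2 * (k + l + 2))" by (simp flip: power_mult power_add add: algebra_simps)
  finally show ?thesis .
qed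

text \<open>
  Polynomially bounded entries have polynomially bounded codes, so it suffices to enumerate codes up
  to a fixed power of the size of the data.
\<close>

lemma tuple_encode_le_power:
  "\<exists>K. \<forall>U ns. 2 \<le> U \<longrightarrow> length ns = n \<longrightarrow> (\<forall>a\<in>set ns. a \<le> U ^ k) \<longrightarrow> tuple_encode ns \<le> U ^ K"
proof (induction n)
  case 0
  show ?case by (rule exI[of _ 0]) (auto simp: tuple_encode_def)
next
  case (Suc n)
  then obtain K where K: "\<And>U ns. 2 \<le> U \<Longrightarrow> length ns = n \<Longrightarrow> (\<forall>a\<in>set ns. a \<le> U ^ k) \<Longrightarrow> tuple_encode ns \<le> U ^ K"
    by blast
  show ?case
  proof (rule exI[of _ "2 * (k + K + 2)"], intro allI impI)
    fix U :: nat and ns assume *: "2 \<le> U" "length ns = Suc n" "\<forall>a\<in>set ns. a \<le> U ^ k"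
    then obtain a ns' where ns: "ns = a # ns'" by (cases ns) auto
    have "tuple_encode ns = prod_encode (a, tuple_encode ns')" by (simp add: ns tuple_encode_def)
    also have "\<dots> \<le> U ^ (2 * (k + K + 2))"
      using * K[of U ns'] by (intro prod_encode_le_power) (auto simp: ns)
    finally show "tuple_encode ns \<le> U ^ (2 * (k + K + 2))" .
  qed
qed

lemma int_encode_bounds: "nat \<bar>i\<bar> \<le> int_encode i" "int_encode i \<le> 2 * nat \<bar>i\<bar>"
  by (auto simp: int_encode_def sum_encode_def)

lemma int_encode_le_power:
  assumes "pow_bdd X k i" "X \<le> int U"
  shows "int_encode i \<le> U ^ Suc k"
proof -
  have X: "2 \<le> X" "\<bar>i\<bar> \<le> X ^ k" using assms by (auto simp: pow_bdd_def)
  have "X ^ k \<le> int U ^ k" using X assms by (intro power_mono) auto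
  hence "int (nat \<bar>i\<bar>) \<le> int (U ^ k)" using X by simp
  hence "nat \<bar>i\<bar> \<le> U ^ k" by (simp only: of_nat_le_iff)
  hence "int_encode i \<le> 2 * U ^ k" using int_encode_bounds(2)[of i] by linarith
  also have "\<dots> \<le> U * U ^ k" using X assms by (intro mult_right_mono) auto
  finally show ?thesis by simp
qed

definition coded_form :: "nat \<Rightarrow> int poly poly" where
  "coded_form j = quartic_form (int_decode (entry 0 j)) (int_decode (entry 1 j))
     (int_decode (entry 2 j)) (int_decode (entry 3 j)) (int_decode (entry 4 j))"

text \<open>
  Nonvanishing of this number guarantees that the coded equation is admissible; every other code is
  discarded.
\<close>

definition coded_test :: "nat \<Rightarrow> int" where
  "coded_test j = int_decode (entry 5 j) * square_obstruction
     (int_decode (entry 0 j)) (int_decode (entry 1 j)) (int_decode (entry 2 j))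
     (int_decode (entry 3 j)) (int_decode (entry 4 j))"

definition coded_equation :: "nat \<Rightarrow> equation option" where
  "coded_equation j =
     (if coded_test j = 0 then None else Some (coded_form j, int_decode (entry 5 j)))"

text \<open>
  Every number codes a triple; the option type only serves to share the enumeration with the
  equations.
\<close>

definition coded_triple :: "nat \<Rightarrow> (int \<times> int \<times> int) option" where
  "coded_triple j = (case prod_decode j of (u, r) \<Rightarrow> case prod_decode r of (v, w) \<Rightarrow>
     Some (int_decode u, int_decode v, int_decode w))"

lemma coded_triple_enc_int3: "coded_triple (enc_int3 s) = Some s"
  by (cases s) (simp add: coded_triple_def enc_int3_def enc_pair_def)

lemma enc_int3_coded_triple: "coded_triple j = Some s \<Longrightarrow> enc_int3 s = j"
  by (auto simp: coded_triple_def enc_int3_def enc_pair_def split: prod.splits)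
    (metis prod_decode_inverse)

lemma enc_equation_coded_form:
  "enc_equation (coded_form j, d) =
    prod_encode (list_encode [entry 0 j, entry 1 j, entry 2 j, entry 3 j, entry 4 j], int_encode d)"
  by (simp add: enc_equation_def enc_pair_def enc_list_def coded_form_def coeff_quartic_form
      upt_rec[of _ 5] upt_rec[of _ "Suc _"] eval_nat_numeral)

lemma rec_fun_bound: "rec_fun 1 (\<lambda>xs. Suc (((xs ! 0 + 2) ^ e) ^ K))"
  by (intro rec_fun_Suc rec_fun_power rec_fun_add rec_fun_const rec_fun_proj) simp

lemma computable_equations:
  "computable enc_p (enc_list enc_equation) (\<lambda>p. collect coded_equation (Suc (((enc_p p + 2) ^ e) ^ K)))"
proof (rule computableI)
  show "rec_fun 1 (\<lambda>xs. enc_list enc_equation (collect coded_equation (Suc (((xs ! 0 + 2) ^ e) ^ K))))"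
  proof (rule rec_fun_collect[OF rec_fun_bound, where F = coded_test])
    show "rec_fun 1 (\<lambda>xs. prod_encode (list_encode [entry 0 (xs ! 0), entry 1 (xs ! 0), entry 2 (xs ! 0),
      entry 3 (xs ! 0), entry 4 (xs ! 0)], entry 5 (xs ! 0)))"
      unfolding list_encode.simps
      by (intro rec_fun_prod_encode rec_fun_Suc rec_fun_entry rec_fun_proj rec_fun_const) simp_all
    show "rec_int_fun 1 (\<lambda>xs. coded_test (xs ! 0))"
      unfolding coded_test_def square_obstruction_def
      by (intro rec_int_fun_add rec_int_fun_diff rec_int_fun_mult rec_int_fun_power rec_int_fun_const
          rec_int_fun_decode rec_fun_entry rec_fun_proj) simp_all
  qed (auto simp: coded_equation_def enc_equation_coded_form split: if_splits)
qed simp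

lemma computable_candidates:
  "computable enc_q (enc_list enc_int3) (\<lambda>q. collect coded_triple (Suc (((enc_q q + 2) ^ e) ^ K)))"
proof (rule computableI)
  show "rec_fun 1 (\<lambda>xs. enc_list enc_int3 (collect coded_triple (Suc (((xs ! 0 + 2) ^ e) ^ K))))"
  proof (rule rec_fun_collect[OF rec_fun_bound, where F = "\<lambda>_. 1" and e = "\<lambda>j. j"])
    show "rec_fun 1 (\<lambda>xs. xs ! 0)" by (rule rec_fun_proj) simp
  qed (auto simp: rec_int_fun_const enc_int3_coded_triple, auto simp: coded_triple_def split: prod.splits)
qed simp

lemma enc_rat_bounds: "quotient_of q = (n, d) \<Longrightarrow> nat \<bar>n\<bar> \<le> enc_rat q \<and> nat \<bar>d\<bar> \<le> enc_rat q"
  using le_prod_encode_1[of "int_encode n" "int_encode d"] le_prod_encode_2[of "int_encode d" "int_encode n"]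
    int_encode_bounds(1)[of n] int_encode_bounds(1)[of d]
  by (simp add: enc_rat_def enc_pair_def)

text \<open>
  The fourth power comes from the products of four numerators and denominators that clear all
  denominators at once.
\<close>

lemma common_denominator:
  fixes a b d1 d2 :: rat
  defines "X \<equiv> (int (enc_data (a, b, d1, d2)) + 2) ^ 4"
  obtains D a' b' d1' d2' :: int where "D \<noteq> 0" "of_int a' = of_int D * a" "of_int b' = of_int D * b"
    "of_int d1' = of_int D * d1" "of_int d2' = of_int D * d2"
    "pow_bdd X 1 a'" "pow_bdd X 1 b'" "pow_bdd X 1 d1'" "pow_bdd X 1 d2'" "pow_bdd X 1 D"
proof -
  define c where "c = enc_data (a, b, d1, d2)"
  obtain p1 q1 p2 q2 p3 q3 p4 q4 where pq: "quotient_of a = (p1, q1)" "quotient_of b = (p2, q2)"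
    "quotient_of d1 = (p3, q3)" "quotient_of d2 = (p4, q4)" by (metis surj_pair)
  have "enc_rat a \<le> c" "enc_rat b \<le> c" "enc_rat d1 \<le> c" "enc_rat d2 \<le> c"
    unfolding c_def enc_data_def enc_pair_def fst_conv snd_conv
    by (meson le_prod_encode_1 le_prod_encode_2 order_trans)+
  hence le: "nat \<bar>p1\<bar> \<le> c" "nat \<bar>q1\<bar> \<le> c" "nat \<bar>p2\<bar> \<le> c" "nat \<bar>q2\<bar> \<le> c"
    "nat \<bar>p3\<bar> \<le> c" "nat \<bar>q3\<bar> \<le> c" "nat \<bar>p4\<bar> \<le> c" "nat \<bar>q4\<bar> \<le> c"
    using pq[THEN enc_rat_bounds] by (auto intro: order_trans)
  have small: "pow_bdd (int c + 2) 1 t" if "nat \<bar>t\<bar> \<le> c" for t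
    using that by (simp add: pow_bdd_def)
  have prod4: "pow_bdd X 1 (t * u * v * w)" if "nat \<bar>t\<bar> \<le> c" "nat \<bar>u\<bar> \<le> c" "nat \<bar>v\<bar> \<le> c" "nat \<bar>w\<bar> \<le> c" for t u v w
  proof -
    have "pow_bdd (int c + 2) (1 + 1 + 1 + 1) (t * u * v * w)"
      by (intro pow_bdd_mult small that)
    hence "pow_bdd (int c + 2) 4 (t * u * v * w)" by (rule pow_bdd_mono) simp
    hence "\<bar>t * u * v * w\<bar> \<le> X" by (simp add: pow_bdd_def X_def c_def)
    moreover have "2 \<le> X" using power_increasing[of 1 4 "int c + 2"] by (simp add: X_def c_def)
    ultimately show ?thesis by (simp add: pow_bdd_def)
  qed
  have q: "q1 \<noteq> 0" "q2 \<noteq> 0" "q3 \<noteq> 0" "q4 \<noteq> 0"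
    using pq[THEN quotient_of_denom_pos] by auto
  have frac: "a = of_int p1 / of_int q1" "b = of_int p2 / of_int q2" "d1 = of_int p3 / of_int q3"
    "d2 = of_int p4 / of_int q4" using pq[THEN quotient_of_div] by auto
  show thesis
  proof (rule that[of "q1 * q2 * q3 * q4" "p1 * q2 * q3 * q4" "q1 * p2 * q3 * q4" "q1 * q2 * p3 * q4" "q1 * q2 * q3 * p4"])
    show "q1 * q2 * q3 * q4 \<noteq> 0" using q by simp
    show "rat_of_int (p1 * q2 * q3 * q4) = of_int (q1 * q2 * q3 * q4) * a"
      "rat_of_int (q1 * p2 * q3 * q4) = of_int (q1 * q2 * q3 * q4) * b"
      "rat_of_int (q1 * q2 * p3 * q4) = of_int (q1 * q2 * q3 * q4) * d1"
      "rat_of_int (q1 * q2 * q3 * p4) = of_int (q1 * q2 * q3 * q4) * d2"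
      using q by (simp_all add: frac)
  qed (intro prod4 le)+
qed

theorem theorem6:
  shows "reduces_to_quartic_thue enc_data enc_int3
    {(a, b, d1, d2). a * b * d2 * (d1 ^ 2 - d2) \<noteq> (0::rat)}
    (\<lambda>(a, b, d1, d2). {(x::int, y::int, z::int).
        rat_of_int z = a * rat_of_int x ^ 2 + d1 \<and>
        rat_of_int z ^ 2 = b * rat_of_int y ^ 2 + d2})"
proof -
  \<comment> \<open>one more than the exponent 40000 of the integers, since coding an integer can double it\<close>
  obtain K where K: "\<And>U ns. 2 \<le> U \<Longrightarrow> length ns = 6 \<Longrightarrow> (\<forall>a\<in>set ns. a \<le> U ^ 40001) \<Longrightarrow> tuple_encode ns \<le> U ^ K"
    using tuple_encode_le_power[of 6 40001] by blast
  define K' :: nat where "K' = 2 * (40001 + 2 * (40001 + 40001 + 2) + 2)"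
  have K': "enc_int3 (x, y, z) \<le> U ^ K'"
    if "2 \<le> U" "int_encode x \<le> U ^ 40001" "int_encode y \<le> U ^ 40001" "int_encode z \<le> U ^ 40001" for U x y z
    unfolding enc_int3_def enc_pair_def K'_def fst_conv snd_conv by (intro prod_encode_le_power that)
  define eqs where "eqs p = collect coded_equation (Suc (((enc_data p + 2) ^ 4) ^ K))" for p
  let ?enc_q = "enc_pair enc_data (enc_pair id (enc_pair int_encode int_encode))"
  define cand where "cand q = collect coded_triple (Suc (((?enc_q q + 2) ^ 5) ^ K'))" for q
  have thue: "quartic_thue_like e" if "e \<in> set (eqs p)" for e p
    using that unfolding eqs_def set_collect
    by (auto simp: coded_equation_def coded_test_def coded_form_def quartic_thue_like_quartic_form split: if_splits)
  have covered: "\<exists>i m n. i < length (eqs (a, b, d1, d2)) \<and>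
      eval2 (fst (eqs (a, b, d1, d2) ! i)) m n = snd (eqs (a, b, d1, d2) ! i) \<and>
      (x, y, z) \<in> set (cand ((a, b, d1, d2), i, m, n))"
    if adm: "a * b * d2 * (d1 ^ 2 - d2) \<noteq> 0"
      and sol: "rat_of_int z = a * rat_of_int x ^ 2 + d1" "rat_of_int z ^ 2 = b * rat_of_int y ^ 2 + d2"
    for a b d1 d2 x y z
  proof -
    let ?p = "(a, b, d1, d2)"
    define c where "c = enc_data ?p"
    define U where "U = (c + 2) ^ 4"
    have U2: "2 \<le> U" using power_increasing[of 1 4 "c + 2"] by (simp add: U_def)
    have X: "(int c + 2) ^ 4 = int U" by (simp add: U_def add.commute)
    obtain D a' b' d1' d2' where D: "D \<noteq> 0" "of_int a' = of_int D * a" "of_int b' = of_int D * b"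
      "of_int d1' = of_int D * d1" "of_int d2' = of_int D * d2"
      and bdd: "pow_bdd (int U) 1 a'" "pow_bdd (int U) 1 b'" "pow_bdd (int U) 1 d1'" "pow_bdd (int U) 1 d2'"
        "pow_bdd (int U) 1 D"
      using common_denominator[of a b d1 d2] unfolding c_def[symmetric] X by blast
    have nz: "a' \<noteq> 0" "b' \<noteq> 0" "d2' \<noteq> 0" 
    proof -
      have "(of_int a' :: rat) \<noteq> 0" "(of_int b' :: rat) \<noteq> 0" "(of_int d2' :: rat) \<noteq> 0"
        unfolding D using adm D(1) by auto
      thus "a' \<noteq> 0" "b' \<noteq> 0" "d2' \<noteq> 0" by simp_all
    qed
    have nz2: "d1'\<^sup>2 \<noteq> D * d2'"
    proof
      assume "d1'\<^sup>2 = D * d2'"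
      hence "(of_int d1' :: rat)\<^sup>2 = of_int D * of_int d2'" by (metis of_int_mult of_int_power)
      hence "(of_int D)\<^sup>2 * (d1\<^sup>2 - d2) = 0" unfolding D by (simp add: algebra_simps power2_eq_square)
      thus False using adm D(1) by simp
    qed
    have "rat_of_int (D * z) = rat_of_int (a' * x\<^sup>2 + d1')" "rat_of_int (D * z\<^sup>2) = rat_of_int (b' * y\<^sup>2 + d2')"
      using sol by (simp_all add: D algebra_simps)
    hence sys: "D * z = a' * x\<^sup>2 + d1'" "D * z\<^sup>2 = b' * y\<^sup>2 + d2'" by (simp_all only: of_int_eq_iff)
    obtain c0 c1 c2 c3 c4 d m n where
      cb: "pow_bdd (int U) 40000 c0" "pow_bdd (int U) 40000 c1" "pow_bdd (int U) 40000 c2" "pow_bdd (int U) 40000 c3"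
        "pow_bdd (int U) 40000 c4" "pow_bdd (int U) 40000 d"
      and test: "d * square_obstruction c0 c1 c2 c3 c4 \<noteq> 0"
      and val: "c4 * m ^ 4 + c3 * m ^ 3 * n + c2 * m\<^sup>2 * n\<^sup>2 + c1 * m * n ^ 3 + c0 * n ^ 4 = d"
      and xyz: "pow_bdd (int U + \<bar>m\<bar> + \<bar>n\<bar>) 40000 x" "pow_bdd (int U + \<bar>m\<bar> + \<bar>n\<bar>) 40000 y"
        "pow_bdd (int U + \<bar>m\<bar> + \<bar>n\<bar>) 40000 z"
      using thue_equation_of_solution[OF bdd nz D(1) nz2 sys] by metis
    define ns where "ns = map int_encode [c0, c1, c2, c3, c4, d]"
    define j where "j = tuple_encode ns"
    have "t \<le> U ^ 40001" if "t \<in> set ns" for t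
      using that cb[THEN int_encode_le_power, OF order_refl] unfolding ns_def Suc_eq_plus1 by auto
    hence "j \<le> U ^ K" unfolding j_def by (intro K U2) (auto simp: ns_def)
    have ent: "entry i j = ns ! i" if "i < 6" for i
      unfolding j_def using that by (intro entry_tuple_encode) (simp add: ns_def)
    have dec: "int_decode (entry 0 j) = c0" "int_decode (entry 1 j) = c1" "int_decode (entry 2 j) = c2"
      "int_decode (entry 3 j) = c3" "int_decode (entry 4 j) = c4" "int_decode (entry 5 j) = d"
      by (simp_all add: ent ns_def)
    have "coded_equation j = Some (quartic_form c0 c1 c2 c3 c4, d)"
      using test unfolding coded_equation_def coded_test_def coded_form_def dec by simp
    hence "(quartic_form c0 c1 c2 c3 c4, d) \<in> set (eqs ?p)"
      using \<open>j \<le> U ^ K\<close> unfolding eqs_def set_collect U_def c_def by (auto simp: less_Suc_eq_le)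
    then obtain i where i: "i < length (eqs ?p)" "eqs ?p ! i = (quartic_form c0 c1 c2 c3 c4, d)"
      by (metis in_set_conv_nth)
    define e where "e = ?enc_q (?p, i, m, n)"
    have "c \<le> e" "int_encode m \<le> e" "int_encode n \<le> e"
      unfolding e_def enc_pair_def c_def fst_conv snd_conv
      by (meson le_prod_encode_1 le_prod_encode_2 order_trans)+
    hence le: "c \<le> e" "nat \<bar>m\<bar> \<le> e" "nat \<bar>n\<bar> \<le> e" using int_encode_bounds(1) order_trans by blast+
    define V where "V = (e + 2) ^ 5"
    have V2: "2 \<le> V" using power_increasing[of 1 5 "e + 2"] by (simp add: V_def)
    have "int U + \<bar>m\<bar> + \<bar>n\<bar> \<le> int V"
    proof -
      have "U \<le> (e + 2) ^ 4" unfolding U_def using le by (intro power_mono) auto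
      \<comment> \<open>the fifth power absorbs the integers \<open>m\<close> and \<open>n\<close>, which are bounded by the code \<open>e\<close>\<close>
      moreover have "2 * e \<le> (e + 2) ^ 4"
      proof -
        have "2 * e \<le> (e + 2)\<^sup>2" by (simp add: power2_eq_square algebra_simps)
        also have "\<dots> \<le> (e + 2) ^ 4" by (rule power_increasing) auto
        finally show ?thesis .
      qed
      moreover have "2 * (e + 2) ^ 4 \<le> V"
      proof -
        have "V = (e + 2) * (e + 2) ^ 4" unfolding V_def using power_add[of "e + 2" 1 4] by simp
        thus ?thesis by (metis le_add2 mult_le_mono1)
      qed
      ultimately show ?thesis using le by linarith
    qed
    hence "enc_int3 (x, y, z) \<le> V ^ K'"
      using xyz[THEN int_encode_le_power] by (intro K' V2) (simp_all only: Suc_eq_plus1, simp_all)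
    hence "(x, y, z) \<in> set (cand (?p, i, m, n))"
      unfolding cand_def set_collect e_def[symmetric] V_def[symmetric]
      using coded_triple_enc_int3 by (auto simp: less_Suc_eq_le)
    with i val show ?thesis by (metis eval2_quartic_form fst_conv snd_conv)
  qed
  show ?thesis unfolding reduces_to_quartic_thue_def
  proof (intro exI[of _ eqs] exI[of _ cand] conjI)
    show "computable enc_data (enc_list enc_equation) eqs"
      unfolding eqs_def by (rule computable_equations)
    show "computable ?enc_q (enc_list enc_int3) cand"
      unfolding cand_def by (rule computable_candidates)
    show "\<forall>p\<in>{(a, b, d1, d2). a * b * d2 * (d1 ^ 2 - d2) \<noteq> (0::rat)}.
       (\<forall>e\<in>set (eqs p). quartic_thue_like e) \<and>
       (\<forall>s\<in>(case p of (a, b, d1, d2) \<Rightarrow> {(x::int, y::int, z::int).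
        rat_of_int z = a * rat_of_int x ^ 2 + d1 \<and>
        rat_of_int z ^ 2 = b * rat_of_int y ^ 2 + d2}). \<exists>i m n. i < length (eqs p) \<and>
              eval2 (fst (eqs p ! i)) m n = snd (eqs p ! i) \<and>
              s \<in> set (cand (p, i, m, n)))"
      using thue covered by (auto 0 0)
  qed
qed

end
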